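(* Let $\Omega$ be an open subset of $\mathbb{C}$, let $\psi \in \Psi$, let $Y$ be a complex uniformly convex (complex) Banach space whose dual $Y^*$ is also complex uniformly convex, and let $\mathcal{Y} := Y \oplus_\psi \mathbb{C}$. Suppose $B$ is the infinitesimal generator of a $C_0$ semigroup on $\mathcal{Y}$ and $B - \lambda I$ is invertible (i.e. $\lambda$ belongs to the resolvent set of $B$) for all $\lambda \in \Omega$, and let $M$ be a real number. If $\|(B-\lambda I)^{-1}\| \le M$ for all $\lambda \in \Omega$, then $\|(B-\lambda I)^{-1}\| < M$ for all $\lambda \in \Omega$.
   Context: A complex Banach space $Y$ is called complex uniformly convex if for every $\varepsilon > 0$ there exists $\delta > 0$ such that: whenever $x, y \in Y$, $\|y\| \ge \varepsilon$ and $\|x + \zeta y\| \le 1$ for all $\zeta \in \mathbb{C}$ with $|\zeta| \le 1$, then $\|x\| \le 1 - \delta$. $\Psi$ denotes the set of all continuous, convex functions $\psi : [0,1] \to \mathbb{R}$ such that $\psi(0) = \psi(1) = 1$ and $\max\{1-t, t\} \le \psi(t) \le 1$ for $0 \le t \le 1$. For $\psi \in \Psi$, a norm on $\mathbb{C}^2$ is defined by $$\|(z, v)\|_\psi = (|z| + |v|)\, \psi\!\left(\frac{|v|}{|z|+|v|}\right) \text{ if } (z,v) \ne (0,0), \qquad \|(0,0)\|_\psi = 0.$$ For Banach spaces $X, Y$, the $\psi$-direct sum $X \oplus_\psi Y$ is the algebraic direct sum $X \oplus Y$ with the norm $\|(x,y)\| = \big\|(\|x\|_X, \|y\|_Y)\big\|_\psi$.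 Resolvent norms are operator norms on $\mathcal{Y}$. A $C_0$ semigroup is a strongly continuous one-parameter semigroup $(T(t))_{t\ge 0}$ of bounded linear operators with $T(0)=I$; it is not assumed to be bounded or contractive. *)

theory Defs
  imports "HOL-Analysis.Analysis"
begin

class complex_vector = real_vector +
  fixes scaleC :: "complex \<Rightarrow> 'a \<Rightarrow> 'a" (infixr "*\<^sub>C" 75)
  assumes scaleC_add_right: "a *\<^sub>C (x + y) = a *\<^sub>C x + a *\<^sub>C y"
    and scaleC_add_left: "(a + b) *\<^sub>C x = a *\<^sub>C x + b *\<^sub>C x"
    and scaleC_scaleC: "a *\<^sub>C b *\<^sub>C x = (a * b) *\<^sub>C x"
    and scaleC_of_real: "complex_of_real r *\<^sub>C x = r *\<^sub>R x"

class complex_normed_vector = complex_vector + real_normed_vector +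
  assumes norm_scaleC: "norm (a *\<^sub>C x) = cmod a * norm x"

class complex_banach = complex_normed_vector + banach

instantiation complex :: complex_banach
begin

definition scaleC_complex :: "complex \<Rightarrow> complex \<Rightarrow> complex"
  where "scaleC_complex a x = a * x"

instance
  by standard (auto simp: scaleC_complex_def algebra_simps norm_mult scaleR_conv_of_real)

end

text \<open>Only the vector space structure of a product is used; its norm is supplied
  separately, since the norm of the direct sum depends on the function \<open>\<psi>\<close>.\<close>

instantiation prod :: (complex_vector, complex_vector) complex_vector
begin

definition scaleC_prod :: "complex \<Rightarrow> 'a \<times> 'b \<Rightarrow> 'a \<times> 'b"
  where "scaleC_prod a p = (a *\<^sub>C fst p, a *\<^sub>C snd p)"

instance
  by standard (auto simp: scaleC_prod_def prod_eq_iff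
      scaleC_add_right scaleC_add_left scaleC_scaleC scaleC_of_real)

end

definition complex_linear :: "('a::complex_vector \<Rightarrow> 'b::complex_vector) \<Rightarrow> bool"
  where "complex_linear f \<longleftrightarrow>
    (\<forall>x y. f (x + y) = f x + f y) \<and> (\<forall>c x. f (c *\<^sub>C x) = c *\<^sub>C f x)"

text \<open>The real-linear bounded maps into \<open>complex\<close> carry the operator norm; the dual consists of
  the complex-linear ones among them, with the restricted norm.\<close>

typedef (overloaded) ('a::complex_normed_vector) cdual =
  "{f :: 'a \<Rightarrow>\<^sub>L complex. complex_linear (blinfun_apply f)}"
  morphisms blinfun_of_cdual cdual_of_blinfun
proof
  show "0 \<in> {f :: 'a \<Rightarrow>\<^sub>L complex. complex_linear (blinfun_apply f)}"
    by (simp add: complex_linear_def scaleC_complex_def)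
qed

setup_lifting type_definition_cdual

lemma bounded_linear_cmult_blinfun:
  "bounded_linear (\<lambda>x. c * blinfun_apply (f :: 'a::real_normed_vector \<Rightarrow>\<^sub>L complex) x)"
  by (rule bounded_linear_compose[OF bounded_linear_mult_right blinfun.bounded_linear_right])

lemma blinfun_apply_cmult:
  "blinfun_apply (Blinfun (\<lambda>x. c * blinfun_apply (f :: 'a::real_normed_vector \<Rightarrow>\<^sub>L complex) x))
    = (\<lambda>x. c * blinfun_apply f x)"
  by (rule bounded_linear_Blinfun_apply[OF bounded_linear_cmult_blinfun])

instantiation cdual :: (complex_normed_vector) complex_normed_vector
begin

lift_definition zero_cdual :: "'a cdual" is 0
  by (simp add: complex_linear_def scaleC_complex_def)

lift_definition plus_cdual :: "'a cdual \<Rightarrow> 'a cdual \<Rightarrow> 'a cdual" is "(+)"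
  by (simp add: complex_linear_def scaleC_complex_def blinfun.add_left algebra_simps)

lift_definition minus_cdual :: "'a cdual \<Rightarrow> 'a cdual \<Rightarrow> 'a cdual" is "(-)"
  by (simp add: complex_linear_def scaleC_complex_def blinfun.diff_left algebra_simps)

lift_definition uminus_cdual :: "'a cdual \<Rightarrow> 'a cdual" is uminus
  by (simp add: complex_linear_def scaleC_complex_def blinfun.minus_left algebra_simps)

lift_definition scaleR_cdual :: "real \<Rightarrow> 'a cdual \<Rightarrow> 'a cdual" is "(*\<^sub>R)"
  by (simp add: complex_linear_def scaleC_complex_def blinfun.scaleR_left algebra_simps)

lift_definition scaleC_cdual :: "complex \<Rightarrow> 'a cdual \<Rightarrow> 'a cdual"
  is "\<lambda>c f. Blinfun (\<lambda>x. c * blinfun_apply f x)"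
  by (simp add: complex_linear_def scaleC_complex_def blinfun_apply_cmult algebra_simps)

lift_definition norm_cdual :: "'a cdual \<Rightarrow> real" is norm .

definition dist_cdual :: "'a cdual \<Rightarrow> 'a cdual \<Rightarrow> real"
  where "dist_cdual f g = norm (f - g)"

definition sgn_cdual :: "'a cdual \<Rightarrow> 'a cdual"
  where "sgn_cdual f = inverse (norm f) *\<^sub>R f"

definition uniformity_cdual :: "('a cdual \<times> 'a cdual) filter"
  where "uniformity_cdual = (INF e\<in>{0<..}. principal {(f, g). dist f g < e})"

definition open_cdual :: "'a cdual set \<Rightarrow> bool"
  where "open_cdual U = (\<forall>f\<in>U. eventually (\<lambda>(f', g). f' = f \<longrightarrow> g \<in> U) uniformity)"

instance
proof
  fix a b :: complex and r s :: real and f g h :: "'a cdual" and U :: "'a cdual set"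
  show "f + g + h = f + (g + h)" by transfer simp
  show "f + g = g + f" by transfer simp
  show "0 + f = f" by transfer simp
  show "- f + f = 0" by transfer simp
  show "f - g = f + - g" by transfer simp
  show "r *\<^sub>R (f + g) = r *\<^sub>R f + r *\<^sub>R g" by transfer (rule scaleR_add_right)
  show "(r + s) *\<^sub>R f = r *\<^sub>R f + s *\<^sub>R f" by transfer (rule scaleR_add_left)
  show "r *\<^sub>R s *\<^sub>R f = (r * s) *\<^sub>R f" by transfer simp
  show "1 *\<^sub>R f = f" by transfer simp
  show "a *\<^sub>C (f + g) = a *\<^sub>C f + a *\<^sub>C g"
    by transfer (rule blinfun_eqI, simp only: blinfun_apply_cmult,
        simp add: blinfun.add_left blinfun.scaleR_left blinfun_apply_cmult
          scaleR_conv_of_real distrib_left distrib_right mult.assoc)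
  show "(a + b) *\<^sub>C f = a *\<^sub>C f + b *\<^sub>C f"
    by transfer (rule blinfun_eqI, simp only: blinfun_apply_cmult,
        simp add: blinfun.add_left blinfun.scaleR_left blinfun_apply_cmult
          scaleR_conv_of_real distrib_left distrib_right mult.assoc)
  show "a *\<^sub>C b *\<^sub>C f = (a * b) *\<^sub>C f"
    by transfer (rule blinfun_eqI, subst blinfun_apply_cmult,
        simp add: blinfun_apply_cmult mult.assoc)
  show "complex_of_real r *\<^sub>C f = r *\<^sub>R f"
    by transfer (rule blinfun_eqI, simp only: blinfun_apply_cmult,
        simp add: blinfun.add_left blinfun.scaleR_left blinfun_apply_cmult
          scaleR_conv_of_real distrib_left distrib_right mult.assoc)
  show "dist f g = norm (f - g)" by (rule dist_cdual_def)
  show "sgn f = inverse (norm f) *\<^sub>R f" by (rule sgn_cdual_def)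
  show "uniformity = (INF e\<in>{0<..}. principal {(f, g :: 'a cdual). dist f g < e})"
    by (rule uniformity_cdual_def)
  show "open U = (\<forall>f\<in>U. \<forall>\<^sub>F (f', g) in uniformity. f' = f \<longrightarrow> g \<in> U)"
    by (rule open_cdual_def)
  show "norm f = 0 \<longleftrightarrow> f = 0" by transfer simp
  show "norm (f + g) \<le> norm f + norm g" by transfer (rule norm_triangle_ineq)
  show "norm (r *\<^sub>R f) = \<bar>r\<bar> * norm f" by transfer simp
  show "norm (a *\<^sub>C f) = cmod a * norm f"
  proof transfer
    fix a and f :: "'a \<Rightarrow>\<^sub>L complex"
    have "onorm (\<lambda>x. a * blinfun_apply f x) = cmod a * onorm (blinfun_apply f)"
    proof (cases "a = 0")
      case True
      then show ?thesis by (simp add: onorm_zero)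
    next
      case False
      have le: "onorm (\<lambda>x. c * g x) \<le> cmod c * onorm g"
        if g: "bounded_linear g" for c :: complex and g :: "'a \<Rightarrow> complex"
      proof (rule onorm_bound)
        show "0 \<le> cmod c * onorm g" by (simp add: onorm_pos_le g)
        show "norm (c * g x) \<le> cmod c * onorm g * norm x" for x
          using mult_left_mono[OF onorm[OF g, of x], of "cmod c"]
          by (simp add: norm_mult mult.assoc)
      qed
      have "onorm (\<lambda>x. inverse a * (a * blinfun_apply f x))
          \<le> cmod (inverse a) * onorm (\<lambda>x. a * blinfun_apply f x)"
        by (rule le[OF bounded_linear_cmult_blinfun])
      then have "cmod a * onorm (blinfun_apply f) \<le> onorm (\<lambda>x. a * blinfun_apply f x)"
        using False
        by (simp add: norm_divide divide_simps mult.commute[of _ "cmod a"] flip: mult.assoc)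
      then show ?thesis
        using le[OF blinfun.bounded_linear_right[of f], of a] by simp
    qed
    then show "norm (Blinfun (\<lambda>x. a * blinfun_apply f x)) = cmod a * norm f"
      by (simp add: norm_blinfun.rep_eq blinfun_apply_cmult)
  qed
qed

end

instance cdual :: (complex_normed_vector) complex_banach
proof
  fix X :: "nat \<Rightarrow> 'a cdual"
  assume X: "Cauchy X"
  have dist_eq: "dist f g = dist (blinfun_of_cdual f) (blinfun_of_cdual g)" for f g :: "'a cdual"
    unfolding dist_norm by transfer simp
  have "Cauchy (\<lambda>n. blinfun_of_cdual (X n))"
    using X unfolding Cauchy_def dist_eq .
  then obtain L where L: "(\<lambda>n. blinfun_of_cdual (X n)) \<longlonglongrightarrow> L"
    by (auto simp: Cauchy_convergent_iff convergent_def)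
  have pt: "(\<lambda>n. blinfun_apply (blinfun_of_cdual (X n)) x) \<longlonglongrightarrow> blinfun_apply L x" for x
    by (intro tendsto_intros L)
  have "blinfun_apply L (c *\<^sub>C x) = c * blinfun_apply L x" for c x
  proof (rule LIMSEQ_unique[OF pt])
    have "blinfun_apply (blinfun_of_cdual (X n)) (c *\<^sub>C x)
        = c * blinfun_apply (blinfun_of_cdual (X n)) x" for n
      using blinfun_of_cdual[of "X n"] by (simp add: complex_linear_def scaleC_complex_def)
    then show "(\<lambda>n. blinfun_apply (blinfun_of_cdual (X n)) (c *\<^sub>C x)) \<longlonglongrightarrow> c * blinfun_apply L x"
      using tendsto_mult[OF tendsto_const pt] by simp
  qed
  then have "complex_linear (blinfun_apply L)"
    by (simp add: complex_linear_def scaleC_complex_def blinfun.add_right)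
  then have "blinfun_of_cdual (cdual_of_blinfun L) = L"
    by (simp add: cdual_of_blinfun_inverse)
  then have "X \<longlonglongrightarrow> cdual_of_blinfun L"
    using L by (simp add: tendsto_iff dist_eq)
  then show "convergent X"
    by (rule convergentI)
qed

definition complex_uniformly_convex :: "'a::complex_banach itself \<Rightarrow> bool"
  where "complex_uniformly_convex _ \<longleftrightarrow>
    (\<forall>\<epsilon>>0. \<exists>\<delta>>0. \<forall>x y :: 'a.
      norm y \<ge> \<epsilon> \<longrightarrow> (\<forall>\<zeta>::complex. cmod \<zeta> \<le> 1 \<longrightarrow> norm (x + \<zeta> *\<^sub>C y) \<le> 1) \<longrightarrow>
      norm x \<le> 1 - \<delta>)"

definition Psi :: "(real \<Rightarrow> real) set"
  where "Psi = {\<psi>. continuous_on {0..1} \<psi> \<and> convex_on {0..1} \<psi> \<and> \<psi> 0 = 1 \<and> \<psi> 1 = 1 \<and>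
    (\<forall>t\<in>{0..1}. max (1 - t) t \<le> \<psi> t \<and> \<psi> t \<le> 1)}"

definition psi_norm :: "(real \<Rightarrow> real) \<Rightarrow> complex \<times> complex \<Rightarrow> real"
  where "psi_norm \<psi> = (\<lambda>(z, v). if (z, v) = (0, 0) then 0
    else (cmod z + cmod v) * \<psi> (cmod v / (cmod z + cmod v)))"

definition psi_sum_norm ::
    "(real \<Rightarrow> real) \<Rightarrow> 'a::complex_normed_vector \<times> 'b::complex_normed_vector \<Rightarrow> real"
  where "psi_sum_norm \<psi> =
    (\<lambda>(x, y). psi_norm \<psi> (complex_of_real (norm x), complex_of_real (norm y)))"

text \<open>Throughout, \<open>N\<close> is the norm of the space. An unbounded operator is given by its domain \<open>D\<close>
  and a function \<open>B\<close> whose values outside \<open>D\<close> are irrelevant.\<close>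

definition bounded_op :: "('v::complex_vector \<Rightarrow> real) \<Rightarrow> ('v \<Rightarrow> 'v) \<Rightarrow> bool"
  where "bounded_op N A \<longleftrightarrow> complex_linear A \<and> (\<exists>K. \<forall>x. N (A x) \<le> K * N x)"

text \<open>The analogue of \<^const>\<open>onorm\<close>; the quotient at \<open>x = 0\<close> is \<open>0\<close>.\<close>

definition op_norm :: "('v::complex_vector \<Rightarrow> real) \<Rightarrow> ('v \<Rightarrow> 'v) \<Rightarrow> real"
  where "op_norm N A = (SUP x. N (A x) / N x)"

definition C0_semigroup :: "('v::complex_vector \<Rightarrow> real) \<Rightarrow> (real \<Rightarrow> 'v \<Rightarrow> 'v) \<Rightarrow> bool"
  where "C0_semigroup N T \<longleftrightarrow>
    (\<forall>t\<ge>0. bounded_op N (T t)) \<and>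
    T 0 = id \<and>
    (\<forall>s\<ge>0. \<forall>t\<ge>0. T (s + t) = T s \<circ> T t) \<and>
    (\<forall>x. \<forall>t\<ge>0. ((\<lambda>s. N (T s x - T t x)) \<longlongrightarrow> 0) (at t within {0..}))"

definition has_generator_value ::
    "('v::complex_vector \<Rightarrow> real) \<Rightarrow> (real \<Rightarrow> 'v \<Rightarrow> 'v) \<Rightarrow> 'v \<Rightarrow> 'v \<Rightarrow> bool"
  where "has_generator_value N T x y \<longleftrightarrow>
    ((\<lambda>h. N ((1 / h) *\<^sub>R (T h x - x) - y)) \<longlongrightarrow> 0) (at_right 0)"

definition is_generator ::
    "('v::complex_vector \<Rightarrow> real) \<Rightarrow> (real \<Rightarrow> 'v \<Rightarrow> 'v) \<Rightarrow> 'v set \<Rightarrow> ('v \<Rightarrow> 'v) \<Rightarrow> bool"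
  where "is_generator N T D B \<longleftrightarrow>
    D = {x. \<exists>y. has_generator_value N T x y} \<and> (\<forall>x\<in>D. has_generator_value N T x (B x))"

definition resolvent :: "'v::complex_vector set \<Rightarrow> ('v \<Rightarrow> 'v) \<Rightarrow> complex \<Rightarrow> 'v \<Rightarrow> 'v"
  where "resolvent D B \<mu> = inv_into D (\<lambda>x. B x - \<mu> *\<^sub>C x)"

definition resolvent_set ::
    "('v::complex_vector \<Rightarrow> real) \<Rightarrow> 'v set \<Rightarrow> ('v \<Rightarrow> 'v) \<Rightarrow> complex set"
  where "resolvent_set N D B =
    {\<mu>. bij_betw (\<lambda>x. B x - \<mu> *\<^sub>C x) D UNIV \<and> bounded_op N (resolvent D B \<mu>)}"

end

theory Submission
  imports Defs
begin

text \<open>Let \<open>R\<close> be the resolvent at a point where its norm attains the bound \<open>M\<close>. Averaging the resolvent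
  over small circles against Fejer kernels gives \<open>\<parallel>R u + \<zeta> c R\<^sup>k\<^sup>+\<^sup>1 u\<parallel> \<le> M \<parallel>u\<parallel>\<close> for \<open>\<bar>\<zeta>\<bar> \<le> 1\<close> and
  \<open>k = 1, 2\<close>. If the \<open>\<psi>\<close>-norm is strictly increasing in its first argument, complex uniform convexity of
  \<open>Y\<close> forces the \<open>Y\<close>-components of \<open>R\<^sup>2 u\<close> and \<open>R\<^sup>3 u\<close> to vanish along a sequence with \<open>\<parallel>R u\<parallel> \<rightarrow> M\<close>, and
  the scalar components are handled by compactness. The semigroup enters only through the
  Landau-Kolmogorov inequality \<open>\<parallel>R u\<parallel> \<le> K \<parallel>R\<^sup>2 u\<parallel> + \<epsilon> \<parallel>u\<parallel>\<close>, which turns smallness of \<open>R\<^sup>2 u\<close> into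
  smallness of \<open>R u\<close>. If the \<open>\<psi>\<close>-norm is not strictly increasing in its first argument, then its dual
  norm is, and the same argument applies to the adjoint of \<open>R\<close> on \<open>Y\<^sup>* \<oplus> \<complex>\<close>.\<close>

section \<open>Complex linear maps and norms\<close>

text \<open>The obstacle is that the direct sum need not be complex uniformly convex: under the
  maximum norm, a perturbation of the Y-component goes unseen while the scalar component dominates.
  Hence only Y-components are accessible to convexity, and only if \<open>\<nu> s 1 > 1\<close> for
  all s > 0; the scalar component is left to compactness. Failure of this condition means that the
  unit sphere of \<nu> has a flat edge from (0, 1) to some (z0, 1), and this very edge makes the
  dual norm strict at (0, 1). The power k = 1 alone leaves a limit of \<open>R\<^sup>2 u\<close> on
  the line of (0, 1). The power k = 2 shows that R maps this line into itself, so that its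
  contribution can be split off. The adjoint semigroup need not be strongly continuous. The
  contribution of the semigroup is therefore distilled into an inequality between operators, which
  can be transposed.\<close>

definition cnorm :: "('v::complex_vector \<Rightarrow> real) \<Rightarrow> bool"
  where "cnorm N \<longleftrightarrow> (\<forall>x y. N (x + y) \<le> N x + N y) \<and> (\<forall>a x. N (a *\<^sub>C x) = cmod a * N x) \<and>
    (\<forall>x. N x = 0 \<longrightarrow> x = 0)"

lemma scaleC_zero_left [simp]: "0 *\<^sub>C (x::'v::complex_vector) = 0"
  using scaleC_of_real[of 0 x] by simp

lemma scaleC_one [simp]: "1 *\<^sub>C (x::'v::complex_vector) = x"
  using scaleC_of_real[of 1 x] by simp

lemma scaleC_zero_right [simp]: "a *\<^sub>C (0::'v::complex_vector) = 0"
  using scaleC_add_right[of a 0 0] by simp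

lemma scaleC_minus_left [simp]: "(- a) *\<^sub>C (x::'v::complex_vector) = - (a *\<^sub>C x)"
  using scaleC_add_left[of "- a" a x] by (simp add: eq_neg_iff_add_eq_0)

lemma scaleC_minus_right [simp]: "a *\<^sub>C (- x::'v::complex_vector) = - (a *\<^sub>C x)"
  using scaleC_add_right[of a "- x" x] by (simp add: eq_neg_iff_add_eq_0)

lemma scaleC_diff_right: "a *\<^sub>C (x - y::'v::complex_vector) = a *\<^sub>C x - a *\<^sub>C y"
  using scaleC_add_right[of a x "- y"] by simp

lemma scaleC_sum_right: "a *\<^sub>C (\<Sum>i\<in>I. f i :: 'v::complex_vector) = (\<Sum>i\<in>I. a *\<^sub>C f i)"
  by (induction I rule: infinite_finite_induct) (simp_all add: scaleC_add_right)

lemma scaleC_sum_left: "(\<Sum>i\<in>I. f i) *\<^sub>C (x :: 'v::complex_vector) = (\<Sum>i\<in>I. f i *\<^sub>C x)"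
  by (induction I rule: infinite_finite_induct) (simp_all add: scaleC_add_left)

lemma complex_linearD:
  assumes "complex_linear f"
  shows complex_linear_add: "f (x + y) = f x + f y"
    and complex_linear_scaleC: "f (c *\<^sub>C x) = c *\<^sub>C f x"
    and complex_linear_zero: "f 0 = 0"
    and complex_linear_diff: "f (x - y) = f x - f y"
    and complex_linear_scaleR: "f (r *\<^sub>R x) = r *\<^sub>R f x"
proof -
  show add: "f (x + y) = f x + f y" for x y using assms by (simp add: complex_linear_def)
  show sc: "f (c *\<^sub>C x) = c *\<^sub>C f x" for c x using assms by (simp add: complex_linear_def)
  show z: "f 0 = 0" using sc[of 0 0] by simp
  have m: "f (- x) = - f x" for x using sc[of "-1" x] by simp
  show "f (x - y) = f x - f y" using add[of x "- y"] m by simp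
  show "f (r *\<^sub>R x) = r *\<^sub>R f x"
    using sc[of "complex_of_real r" x] by (simp add: scaleC_of_real)
qed

lemma complex_linear_funpow:
  fixes f :: "'v::complex_vector \<Rightarrow> 'v"
  assumes "complex_linear f" shows "complex_linear (f ^^ n)"
  using assms by (induction n) (simp_all add: complex_linear_def)

lemma cnormD:
  assumes "cnorm N"
  shows cnorm_triangle: "N (x + y) \<le> N x + N y"
    and cnorm_scaleC: "N (a *\<^sub>C x) = cmod a * N x"
    and cnorm_eq_0D: "N x = 0 \<Longrightarrow> x = 0"
    and cnorm_zero: "N 0 = 0"
    and cnorm_minus: "N (- x) = N x"
    and cnorm_scaleR: "N (r *\<^sub>R x) = \<bar>r\<bar> * N x"
    and cnorm_nonneg: "0 \<le> N x"
    and cnorm_triangle_diff: "N (x - y) \<le> N x + N y"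
    and cnorm_triangle_sub: "N x \<le> N y + N (x - y)"
proof -
  show tri: "N (x + y) \<le> N x + N y" for x y using assms by (simp add: cnorm_def)
  show sc: "N (a *\<^sub>C x) = cmod a * N x" for a x using assms by (simp add: cnorm_def)
  show "N x = 0 \<Longrightarrow> x = 0" using assms by (simp add: cnorm_def)
  show z: "N 0 = 0" using sc[of 0 0] by simp
  show m: "N (- x) = N x" for x using sc[of "- 1" x] by simp
  show "N (r *\<^sub>R x) = \<bar>r\<bar> * N x" using sc[of "complex_of_real r" x] by (simp add: scaleC_of_real)
  show "0 \<le> N x" using tri[of x "- x"] by (simp add: m z)
  show "N (x - y) \<le> N x + N y" using tri[of x "- y"] by (simp add: m)
  show "N x \<le> N y + N (x - y)" using tri[of y "x - y"] by simp
qed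

lemma cnorm_sum:
  assumes "cnorm N" shows "N (\<Sum>i\<in>I. f i) \<le> (\<Sum>i\<in>I. N (f i))"
proof (induction I rule: infinite_finite_induct)
  case (insert i I)
  then show ?case using cnorm_triangle[OF assms, of "f i" "sum f I"] by simp
qed (simp_all add: cnorm_zero[OF assms])

section \<open>The Hahn-Banach theorem\<close>

definition sublin :: "('v::real_vector \<Rightarrow> real) \<Rightarrow> bool"
  where "sublin p \<longleftrightarrow> (\<forall>x y. p (x + y) \<le> p x + p y) \<and> (\<forall>r x. r \<ge> 0 \<longrightarrow> p (r *\<^sub>R x) = r * p x)"

lemma sublinD:
  assumes "sublin p"
  shows sublin_add: "p (x + y) \<le> p x + p y"
    and sublin_scaleR: "r \<ge> 0 \<Longrightarrow> p (r *\<^sub>R x) = r * p x"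
    and sublin_zero: "p 0 = 0"
    and sublin_minus: "- p (- x) \<le> p x"
proof -
  show a: "p (x + y) \<le> p x + p y" for x y using assms by (simp add: sublin_def)
  show "r \<ge> 0 \<Longrightarrow> p (r *\<^sub>R x) = r * p x" for r x using assms by (simp add: sublin_def)
  from this[of 0 0] show z: "p 0 = 0" by simp
  show "- p (- x) \<le> p x" using a[of x "- x"] by (simp add: z)
qed

text \<open>The infimum over t >= 0 of q(x + t y) - t q(y) pushes q down in the direction -y: at x =
  -y the choice t = 1 gives q(0) - q(y). It is finite because t q(y) <= q(x + t y) + q(-x).\<close>

lemma sublin_lower:
  fixes q :: "'v::real_vector \<Rightarrow> real"
  assumes q: "sublin q"
  obtains q' where "sublin q'" "q' \<le> q" "q' (- y) \<le> - q y"
proof -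
  define q' where "q' x = (INF t\<in>{0..}. q (x + t *\<^sub>R y) - t * q y)" for x
  have lb: "- q (- x) \<le> q (x + t *\<^sub>R y) - t * q y" if "t \<ge> 0" for x t
    using sublin_add[OF q, of "x + t *\<^sub>R y" "- x"] that by (simp add: sublin_scaleR[OF q])
  then have bdd: "bdd_below ((\<lambda>t. q (x + t *\<^sub>R y) - t * q y) ` {0..})" for x
    by (intro bdd_belowI2[of _ "- q (- x)"]) auto
  have le: "q' x \<le> q (x + t *\<^sub>R y) - t * q y" if "t \<ge> 0" for x t
    unfolding q'_def using that by (intro cINF_lower bdd) auto
  have ge: "a \<le> q' x" if "\<And>t. t \<ge> 0 \<Longrightarrow> a \<le> q (x + t *\<^sub>R y) - t * q y" for a x
    unfolding q'_def using that by (intro cINF_greatest) auto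
  have "q' (u + v) \<le> q' u + q' v" for u v
  proof -
    have "q' (u + v) - (q (v + t *\<^sub>R y) - t * q y) \<le> q' u" if "t \<ge> 0" for t
    proof (rule ge)
      fix s :: real assume s: "s \<ge> 0"
      have "q' (u + v) \<le> q (u + v + (s + t) *\<^sub>R y) - (s + t) * q y"
        using s that by (intro le) simp
      also have "\<dots> \<le> q (u + s *\<^sub>R y) + q (v + t *\<^sub>R y) - (s + t) * q y"
        using sublin_add[OF q, of "u + s *\<^sub>R y" "v + t *\<^sub>R y"] by (simp add: algebra_simps)
      finally show "q' (u + v) - (q (v + t *\<^sub>R y) - t * q y) \<le> q (u + s *\<^sub>R y) - s * q y"
        by (simp add: algebra_simps)
    qed
    then have "q' (u + v) - q' u \<le> q' v" by (intro ge) (simp add: algebra_simps)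
    then show ?thesis by simp
  qed
  moreover have "q' (r *\<^sub>R x) = r * q' x" if "r \<ge> 0" for r x
  proof (cases "r = 0")
    case True
    have "q' 0 = 0"
      using le[of 0 0] lb[of _ 0] by (intro antisym ge) (simp_all add: sublin_zero[OF q] sublin_scaleR[OF q])
    then show ?thesis using True by simp
  next
    case False
    have half: "c * q' x \<le> q' (c *\<^sub>R x)" if c: "c > 0" for c x
    proof (rule ge)
      fix t :: real assume t: "t \<ge> 0"
      have "q' x \<le> q (x + (t / c) *\<^sub>R y) - (t / c) * q y" using c t by (intro le) simp
      then have "c * q' x \<le> c * q (x + (t / c) *\<^sub>R y) - t * q y"
        using c by (simp add: field_simps)
      also have "c * q (x + (t / c) *\<^sub>R y) = q (c *\<^sub>R (x + (t / c) *\<^sub>R y))"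
        using c by (simp add: sublin_scaleR[OF q])
      also have "c *\<^sub>R (x + (t / c) *\<^sub>R y) = c *\<^sub>R x + t *\<^sub>R y"
        using c by (simp add: scaleR_add_right)
      finally show "c * q' x \<le> q (c *\<^sub>R x + t *\<^sub>R y) - t * q y" .
    qed
    have r: "r > 0" using False that by simp
    have "inverse r * q' (r *\<^sub>R x) \<le> q' x" using half[of "inverse r" "r *\<^sub>R x"] r by simp
    then have "q' (r *\<^sub>R x) \<le> r * q' x" using r by (simp add: field_simps)
    then show ?thesis using half[OF r, of x] by simp
  qed
  ultimately have "sublin q'" by (simp add: sublin_def)
  moreover have "q' \<le> q" by (rule le_funI) (use le[of 0] in simp)
  moreover have "q' (- y) \<le> - q y" using le[of 1 "- y"] by (simp add: sublin_zero[OF q])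
  ultimately show ?thesis by (rule that)
qed

text \<open>A minimal sublinear functional below \<open>p\<close> is linear, by \<open>sublin_lower\<close>.\<close>

lemma hahn_banach:
  fixes p :: "'v::real_vector \<Rightarrow> real"
  assumes p: "sublin p"
  obtains f where "linear f" "\<And>x. f x \<le> p x" "f x0 = p x0"
proof -
  \<comment> \<open>Lowering p at x0 before minimizing builds the norming condition in: any linear f
    below p0 has f(-x0) <= -p(x0), hence f(x0) >= p(x0).\<close>
  obtain p0 where p0: "sublin p0" "p0 \<le> p" "p0 (- x0) \<le> - p x0"
    using sublin_lower[OF p] .
  define S where "S = {q. sublin q \<and> q \<le> p0}"
  have "\<exists>q\<in>S. \<forall>q'\<in>S. q' \<le> q \<longrightarrow> q' = q"
  proof (rule predicate_Zorn[where P = "(\<ge>)"])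
    show "partial_order_on S (relation_of (\<ge>) S)"
      by (rule partial_order_on_relation_ofI) auto
    fix C assume "C \<in> Chains (relation_of (\<ge>) S)"
    then have CS: "C \<subseteq> S" and tot: "\<And>a b. a \<in> C \<Longrightarrow> b \<in> C \<Longrightarrow> a \<le> b \<or> b \<le> a"
      by (auto simp: Chains_def relation_of_def)
    show "\<exists>u\<in>S. \<forall>a\<in>C. u \<le> a"
    proof (cases "C = {}")
      case True
      then show ?thesis using p0 by (auto simp: S_def)
    next
      case False
      define u where "u x = (INF q\<in>C. q x)" for x
      \<comment> \<open>A lower bound common to all members of S keeps the pointwise infimum of a
        chain finite.\<close>
      have lb: "- p0 (- x) \<le> q x" if "q \<in> C" for q x
      proof -
        have "sublin q" "q \<le> p0" using that CS by (auto simp: S_def)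
        then show ?thesis using sublin_minus[of q x] le_funD[of q p0 "- x"] by simp
      qed
      have le: "u x \<le> q x" if "q \<in> C" for q x
        unfolding u_def using that by (intro cINF_lower bdd_belowI2[of _ "- p0 (- x)"] lb)
      have ge: "a \<le> u x" if "\<And>q. q \<in> C \<Longrightarrow> a \<le> q x" for a x
        unfolding u_def using that False by (intro cINF_greatest)
      have add: "u (x + y) \<le> u x + u y" for x y
      proof -
        have "u (x + y) - q y \<le> u x" if q: "q \<in> C" for q
        proof (rule ge)
          fix q' assume q': "q' \<in> C"
          \<comment> \<open>An infimum of sublinear functionals is in general not subadditive;
            comparability within the chain supplies one r below both q and q'.\<close>
          obtain r where r: "r \<in> C" "r \<le> q" "r \<le> q'" using tot[OF q q'] q q' by auto
          have "u (x + y) \<le> r (x + y)" by (rule le) fact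
          also have "\<dots> \<le> r x + r y" using r CS by (intro sublin_add) (auto simp: S_def)
          also have "\<dots> \<le> q' x + q y" using r by (intro add_mono) (auto dest: le_funD)
          finally show "u (x + y) - q y \<le> q' x" by simp
        qed
        then have "u (x + y) - u x \<le> u y" by (intro ge) (simp add: algebra_simps)
        then show ?thesis by simp
      qed
      have sub: "sublin q" if "q \<in> C" for q using that CS by (auto simp: S_def)
      have "u (r *\<^sub>R x) = r * u x" if r: "r \<ge> 0" for r x
      proof (cases "r = 0")
        case True
        obtain q where q: "q \<in> C" using False by auto
        have "u 0 \<le> 0" using le[OF q, of 0] sublin_zero[OF sub[OF q]] by simp
        moreover have "0 \<le> u 0" by (rule ge) (simp add: sublin_zero[OF sub])
        ultimately show ?thesis using True by simp
      next
        case False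
        then have r0: "r > 0" using r by simp
        show ?thesis
        proof (rule antisym)
          have "u (r *\<^sub>R x) / r \<le> u x"
            by (rule ge) (use le[of _ "r *\<^sub>R x"] r0 in \<open>simp add: sublin_scaleR[OF sub] field_simps\<close>)
          then show "u (r *\<^sub>R x) \<le> r * u x" using r0 by (simp add: field_simps)
          show "r * u x \<le> u (r *\<^sub>R x)"
            by (rule ge) (use le r0 in \<open>simp add: sublin_scaleR[OF sub]\<close>)
        qed
      qed
      moreover have sub_le: "q x \<le> p0 x" if "q \<in> C" for q x
        using that CS by (auto simp: S_def le_fun_def)
      ultimately have "sublin u" using add by (simp add: sublin_def)
      moreover obtain q where "q \<in> C" using False by auto
      then have "u \<le> p0" using le CS by (intro le_funI) (meson order_trans sub_le)
      ultimately show ?thesis using le by (auto simp: S_def le_fun_def)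
    qed
  qed
  then obtain f where f: "sublin f" "f \<le> p0" and min: "\<And>q. sublin q \<Longrightarrow> q \<le> f \<Longrightarrow> q = f"
    by (auto simp: S_def)
  have neg: "f (- y) = - f y" for y
  proof -
    obtain q where "sublin q" "q \<le> f" "q (- y) \<le> - f y" using sublin_lower[OF f(1)] .
    then have "f (- y) \<le> - f y" using min[of q] by simp
    then show ?thesis using sublin_minus[OF f(1), of y] by simp
  qed
  have "linear f"
  proof
    fix x y :: 'v and r :: real
    have "f (x + y) - f y \<ge> f x"
      using sublin_add[OF f(1), of "x + y" "- y"] by (simp add: neg)
    then show "f (x + y) = f x + f y" using sublin_add[OF f(1), of x y] by simp
    show "f (r *\<^sub>R x) = r *\<^sub>R f x"
    proof (cases "r \<ge> 0")
      case True
      then show ?thesis by (simp add: sublin_scaleR[OF f(1)])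
    next
      case False
      then have "f ((- r) *\<^sub>R (- x)) = (- r) * f (- x)" by (intro sublin_scaleR f(1)) simp
      then show ?thesis by (simp add: neg)
    qed
  qed
  moreover have le: "f x \<le> p x" for x
    using f(2) p0(2) by (auto dest: le_funD intro: order_trans)
  moreover have "f x0 = p x0"
    using le[of x0] le_funD[OF f(2), of "- x0"] p0(3) by (simp add: neg)
  ultimately show ?thesis by (rule that)
qed

section \<open>Semigroups and the Landau-Kolmogorov inequality\<close>

text \<open>Baire: the closed sets \<open>G k\<close> exhaust the complete domain, so one of them
  contains a ball of radius r about some x0. Vectors of length r are differences of two points of
  that ball, whence the bound 2k/r.\<close>

lemma uniform_boundedness:
  fixes T :: "'i \<Rightarrow> 'v::banach \<Rightarrow> 'w::real_normed_vector"
  assumes T: "\<And>i. bounded_linear (T i)" and pw: "\<And>x. \<exists>K. \<forall>i. norm (T i x) \<le> K"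
  obtains K where "\<And>i x. norm (T i x) \<le> K * norm x"
proof -
  define G where "G k = {x. \<forall>i. norm (T i x) \<le> real k}" for k :: nat
  have cl: "closed (G k)" for k
    unfolding G_def using T
    by (intro closed_Collect_all closed_Collect_le continuous_intros)
      (auto intro: linear_continuous_on)
  have un: "(\<Union>k. G k) = UNIV"
  proof safe
    fix x
    obtain K where K: "\<forall>i. norm (T i x) \<le> K" using pw by blast
    obtain k where "K \<le> real k" using real_arch_simple by blast
    then have "x \<in> G k" using K by (auto simp: G_def intro: order_trans)
    then show "x \<in> (\<Union>k. G k)" by blast
  qed simp
  have "\<exists>k. interior (G k) \<noteq> {}"
  proof (rule ccontr)
    assume "\<not> ?thesis"
    then have "euclidean interior_of \<Union>(range G) = {}"
      by (intro Baire_category_alt) (auto simp: completely_metrizable_space_euclidean cl)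
    then show False by (simp add: un)
  qed
  then obtain k x0 where "x0 \<in> interior (G k)" by auto
  then obtain r where r: "r > 0" "cball x0 r \<subseteq> G k"
    by (auto simp: mem_interior_cball)
  have "norm (T i y) \<le> (2 * real k / r) * norm y" for i y
  proof (cases "y = 0")
    case True
    then show ?thesis using T[of i] by (simp add: linear_simps)
  next
    case False
    define c where "c = r / norm y"
    have c: "c > 0" using r False by (simp add: c_def)
    have "x0 \<in> G k" using r by auto
    moreover have "x0 + c *\<^sub>R y \<in> G k" using r False by (intro subsetD[OF r(2)]) (simp add: dist_norm c_def)
    ultimately have "norm (T i x0) \<le> k" "norm (T i (x0 + c *\<^sub>R y)) \<le> k" by (auto simp: G_def)
    moreover have "c *\<^sub>R T i y = T i (x0 + c *\<^sub>R y) - T i x0"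
      using T[of i] by (simp add: linear_simps)
    ultimately have "norm (c *\<^sub>R T i y) \<le> 2 * real k"
      using norm_triangle_ineq4[of "T i (x0 + c *\<^sub>R y)" "T i x0"] by simp
    then show ?thesis using c False r by (simp add: c_def field_simps)
  qed
  then show ?thesis by (rule that)
qed

lemma bounded_opD:
  assumes "bounded_op N A" and N: "cnorm N"
  shows "complex_linear A" "\<exists>K\<ge>0. \<forall>x. N (A x) \<le> K * N x"
proof -
  show "complex_linear A" using assms by (simp add: bounded_op_def)
  obtain K where "\<forall>x. N (A x) \<le> K * N x" using assms by (auto simp: bounded_op_def)
  then have "N (A x) \<le> \<bar>K\<bar> * N x" for x
    using mult_right_mono[OF abs_ge_self, of "N x" K] cnorm_nonneg[OF N, of x] by (meson order_trans)
  then show "\<exists>K\<ge>0. \<forall>x. N (A x) \<le> K * N x" by (intro exI[of _ "\<bar>K\<bar>"]) auto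
qed

lemma C0_semigroupD:
  assumes "C0_semigroup N T"
  shows "t \<ge> 0 \<Longrightarrow> bounded_op N (T t)" "T 0 x = x"
    "s \<ge> 0 \<Longrightarrow> t \<ge> 0 \<Longrightarrow> T (s + t) x = T s (T t x)"
    "((\<lambda>s. N (T s x - x)) \<longlongrightarrow> 0) (at 0 within {0..})"
  using assms unfolding C0_semigroup_def by (auto dest!: spec[of _ x])

text \<open>Along a hypothetical sequence of times tending to 0 with growing operator norms, strong
  continuity at 0 gives pointwise boundedness, so the uniform boundedness principle applies. That
  principle is formulated for \<open>norm\<close>; the equivalence of N with \<open>norm\<close>
  makes it available.\<close>

lemma C0_semigroup_bounded_near_0:
  fixes N :: "'v::{complex_vector,banach} \<Rightarrow> real"
  assumes N: "cnorm N" and S: "C0_semigroup N T"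
    and eqv: "\<And>x. norm x \<le> K1 * N x" "\<And>x. N x \<le> K2 * norm x" and K: "K1 > 0" "K2 > 0"
  obtains d C where "d > 0" "C > 0" "\<And>t x. 0 \<le> t \<Longrightarrow> t \<le> d \<Longrightarrow> N (T t x) \<le> C * N x"
proof -
  \<comment> \<open>One n limits the time and bounds the operator, so the negation yields times
    tending to 0 together with unbounded growth.\<close>
  have "\<exists>n::nat. \<forall>t x. 0 \<le> t \<longrightarrow> t \<le> 1 / (real n + 1) \<longrightarrow> N (T t x) \<le> (real n + 1) * N x"
  proof (rule ccontr)
    assume "\<not> ?thesis"
    then have "\<forall>n. \<exists>t x. 0 \<le> t \<and> t \<le> 1 / (real n + 1) \<and> N (T t x) > (real n + 1) * N x"
      by (simp add: not_le)
    then obtain t x where t: "\<And>n. 0 \<le> t n" "\<And>n. t n \<le> 1 / (real n + 1)"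
      and x: "\<And>n. N (T (t n) (x n)) > (real n + 1) * N (x n)"
      by metis
    have t0: "t \<longlonglongrightarrow> 0"
    proof (rule tendsto_sandwich[OF _ _ tendsto_const])
      show "(\<lambda>n. 1 / (real n + 1)) \<longlonglongrightarrow> 0"
        using LIMSEQ_inverse_real_of_nat by (simp add: inverse_eq_divide add.commute)
    qed (use t in auto)
    have bl: "bounded_linear (T (t n))" for n
    proof -
      obtain L where L: "L \<ge> 0" "\<forall>x. N (T (t n) x) \<le> L * N x"
        using bounded_opD(2)[OF C0_semigroupD(1)[OF S t(1)] N] by blast
      have lin: "complex_linear (T (t n))" by (rule bounded_opD(1)[OF C0_semigroupD(1)[OF S t(1)] N])
      show ?thesis
      proof (rule bounded_linear_intro[where K = "K1 * L * K2"])
        fix x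
        have "norm (T (t n) x) \<le> K1 * N (T (t n) x)" by (rule eqv)
        also have "\<dots> \<le> K1 * (L * (K2 * norm x))"
          using L eqv(2)[of x] K by (meson mult_left_mono order_trans less_imp_le)
        finally show "norm (T (t n) x) \<le> norm x * (K1 * L * K2)" by (simp add: mult_ac)
      qed (simp_all add: complex_linear_add[OF lin] complex_linear_scaleR[OF lin])
    qed
    have "\<exists>K. \<forall>n. norm (T (t n) y) \<le> K" for y
    proof -
      have lim: "((\<lambda>s. N (T s y - y)) \<longlongrightarrow> N (T 0 y - y)) (at 0 within {0..})"
        using C0_semigroupD(2,4)[OF S, where x = y] by (simp add: cnorm_zero[OF N])
      have "continuous (at 0 within {0..}) (\<lambda>s. N (T s y - y))"
        using lim by (simp add: continuous_within)
      then have "(\<lambda>n. N (T (t n) y - y)) \<longlonglongrightarrow> N (T 0 y - y)"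
        using t t0 by (auto simp: continuous_within_sequentially o_def)
      then have "Bseq (\<lambda>n. N (T (t n) y - y))"
        by (intro convergent_imp_Bseq) (auto simp: convergent_def)
      then obtain L where L: "\<And>n. N (T (t n) y - y) \<le> L" by (auto simp: Bseq_def abs_le_iff)
      have "norm (T (t n) y) \<le> K1 * (N y + L)" for n
        using eqv(1)[of "T (t n) y"] cnorm_triangle_sub[OF N, of "T (t n) y" y] L[of n] K
        by (smt (verit) mult_left_mono)
      then show ?thesis by blast
    qed
    then obtain L where L: "\<And>n y. norm (T (t n) y) \<le> L * norm y"
      using uniform_boundedness[of "\<lambda>n. T (t n)", OF bl] by blast
    have bnd: "N (T (t n) y) \<le> (K2 * \<bar>L\<bar> * K1) * N y" for n y
    proof -
      have "norm (T (t n) y) \<le> \<bar>L\<bar> * norm y"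
        using L[of n y] mult_right_mono[OF abs_ge_self, of "norm y" L] by simp
      also have "\<dots> \<le> \<bar>L\<bar> * (K1 * N y)" by (intro mult_left_mono eqv) simp
      finally have "K2 * norm (T (t n) y)
          \<le> K2 * (\<bar>L\<bar> * (K1 * N y))"
        using K by (intro mult_left_mono) auto
      then show ?thesis using eqv(2)[of "T (t n) y"] by (simp add: mult.assoc)
    qed
    obtain n where n: "K2 * \<bar>L\<bar> * K1 \<le> real n" using real_arch_simple by blast
    have "(real n + 1) * N (x n) < (K2 * \<bar>L\<bar> * K1) * N (x n)"
      using x[of n] bnd[of n "x n"] by simp
    also have "\<dots> \<le> (real n + 1) * N (x n)"
      using n cnorm_nonneg[OF N, of "x n"] by (intro mult_right_mono) auto
    finally show False by simp
  qed
  then obtain n where "\<And>t x. 0 \<le> t \<Longrightarrow> t \<le> 1 / (real n + 1) \<Longrightarrow> N (T t x) \<le> (real n + 1) * N x"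
    by blast
  then show ?thesis by (intro that[of "1 / (real n + 1)" "real n + 1"]) auto
qed

section \<open>Expansions of a semigroup on the domain of its generator\<close>

lemma has_generator_value_unique:
  assumes N: "cnorm N" and "has_generator_value N T x y" "has_generator_value N T x y'"
  shows "y = y'"
proof -
  define q where "q h = (1 / h) *\<^sub>R (T h x - x)" for h
  have "((\<lambda>h. N (q h - y) + N (q h - y')) \<longlongrightarrow> 0 + 0) (at_right 0)"
    using assms(2,3) unfolding has_generator_value_def q_def by (intro tendsto_add)
  moreover have "N (y - y') \<le> N (q h - y) + N (q h - y')" for h
    using cnorm_triangle_diff[OF N, of "q h - y'" "q h - y"] by simp
  ultimately have "N (y - y') \<le> 0"
    by (intro tendsto_lowerbound[where F = "at_right (0::real)"]) auto
  then show ?thesis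
    using cnorm_nonneg[OF N, of "y - y'"] cnorm_eq_0D[OF N, of "y - y'"] by simp
qed

lemma has_generator_value_add_scaleC:
  assumes N: "cnorm N" and S: "C0_semigroup N T"
    and x: "has_generator_value N T x y" "has_generator_value N T x' y'"
  shows "has_generator_value N T (x + c *\<^sub>C x') (y + c *\<^sub>C y')"
  unfolding has_generator_value_def
proof (rule Lim_null_comparison)
  show "((\<lambda>h. N ((1 / h) *\<^sub>R (T h x - x) - y) + cmod c * N ((1 / h) *\<^sub>R (T h x' - x') - y')) \<longlongrightarrow> 0) (at_right 0)"
    using x unfolding has_generator_value_def
    by (intro tendsto_add_zero tendsto_mult_right_zero)
  have "norm (N ((1 / h) *\<^sub>R (T h (x + c *\<^sub>C x') - (x + c *\<^sub>C x')) - (y + c *\<^sub>C y')))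
      \<le> N ((1 / h) *\<^sub>R (T h x - x) - y) + cmod c * N ((1 / h) *\<^sub>R (T h x' - x') - y')" if "h > 0" for h
  proof -
    have lin: "complex_linear (T h)" using bounded_opD(1)[OF C0_semigroupD(1)[OF S] N] that by simp
    have "(1 / h) *\<^sub>R c *\<^sub>C z = c *\<^sub>C (1 / h) *\<^sub>R z" for z :: 'a
      unfolding scaleC_of_real[symmetric] scaleC_scaleC by (simp add: mult.commute)
    then have "(1 / h) *\<^sub>R (T h (x + c *\<^sub>C x') - (x + c *\<^sub>C x')) - (y + c *\<^sub>C y')
      = ((1 / h) *\<^sub>R (T h x - x) - y) + c *\<^sub>C ((1 / h) *\<^sub>R (T h x' - x') - y')"
      by (simp add: complex_linear_add[OF lin] complex_linear_scaleC[OF lin] scaleC_diff_right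
          scaleR_diff_right scaleR_add_right)
    then show ?thesis
      using cnorm_triangle[OF N, of "(1 / h) *\<^sub>R (T h x - x) - y" "c *\<^sub>C ((1 / h) *\<^sub>R (T h x' - x') - y')"]
      by (simp only: real_norm_def abs_of_nonneg[OF cnorm_nonneg[OF N]] cnorm_scaleC[OF N])
  qed
  then show "\<forall>\<^sub>F h in at_right 0. norm (N ((1 / h) *\<^sub>R (T h (x + c *\<^sub>C x') - (x + c *\<^sub>C x')) - (y + c *\<^sub>C y')))
      \<le> N ((1 / h) *\<^sub>R (T h x - x) - y) + cmod c * N ((1 / h) *\<^sub>R (T h x' - x') - y')"
    by (auto simp: eventually_at_right_field intro: exI[of _ 1])
qed

lemma has_generator_value_semigroup:
  assumes N: "cnorm N" and S: "C0_semigroup N T" and x: "has_generator_value N T x y" and t: "t \<ge> 0"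
  shows "has_generator_value N T (T t x) (T t y)"
proof -
  obtain K where K: "K \<ge> 0" "\<And>x. N (T t x) \<le> K * N x" and lin: "complex_linear (T t)"
    using bounded_opD[OF C0_semigroupD(1)[OF S t] N] by blast
  show ?thesis
    unfolding has_generator_value_def
  proof (rule Lim_null_comparison)
    show "((\<lambda>h. K * N ((1 / h) *\<^sub>R (T h x - x) - y)) \<longlongrightarrow> 0) (at_right 0)"
      using x unfolding has_generator_value_def by (rule tendsto_mult_right_zero)
    have "norm (N ((1 / h) *\<^sub>R (T h (T t x) - T t x) - T t y)) \<le> K * N ((1 / h) *\<^sub>R (T h x - x) - y)"
      if "h > 0" for h
    proof -
      have "T h (T t x) = T t (T h x)"
        using C0_semigroupD(3)[OF S, of h t x] C0_semigroupD(3)[OF S, of t h x] t that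
        by (simp add: add.commute)
      then have "(1 / h) *\<^sub>R (T h (T t x) - T t x) - T t y = T t ((1 / h) *\<^sub>R (T h x - x) - y)"
        by (simp add: complex_linear_diff[OF lin] complex_linear_scaleR[OF lin])
      then show ?thesis using K by (simp add: cnorm_nonneg[OF N])
    qed
    then show "\<forall>\<^sub>F h in at_right 0. norm (N ((1 / h) *\<^sub>R (T h (T t x) - T t x) - T t y))
        \<le> K * N ((1 / h) *\<^sub>R (T h x - x) - y)"
      by (auto simp: eventually_at_right_field intro: exI[of _ 1])
  qed
qed

text \<open>Cuts [0, s] into n equal steps so short that each is linear up to a relative error e.
  Summing over such steps replaces integration along the orbit in the two estimates below.\<close>

lemma has_generator_value_step:
  assumes N: "cnorm N" and x: "has_generator_value N T x y" and e: "e > 0" and s: "s > 0"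
  obtains n :: nat where "n > 0" "N (T (s / n) x - x - (s / n) *\<^sub>R y) \<le> e * (s / n)"
proof -
  have "\<forall>\<^sub>F h in at_right 0. N ((1 / h) *\<^sub>R (T h x - x) - y) < e"
    using x e unfolding has_generator_value_def by (rule order_tendstoD)
  then obtain b where b: "b > 0" "\<And>h. 0 < h \<Longrightarrow> h < b \<Longrightarrow> N ((1 / h) *\<^sub>R (T h x - x) - y) < e"
    by (auto simp: eventually_at_right_field)
  obtain n where n: "s / b < real n" using reals_Archimedean2 by blast
  then have "real n > 0" using s b by (meson divide_pos_pos less_trans)
  define h where "h = s / real n"
  have h: "0 < h" "h < b" using n s b \<open>real n > 0\<close> by (auto simp: h_def field_simps)
  have "T h x - x - h *\<^sub>R y = h *\<^sub>R ((1 / h) *\<^sub>R (T h x - x) - y)"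
    using h by (simp add: scaleR_diff_right)
  then have "N (T h x - x - h *\<^sub>R y) = h * N ((1 / h) *\<^sub>R (T h x - x) - y)"
    using h by (simp add: cnorm_scaleR[OF N])
  also have "\<dots> \<le> h * e" using b(2)[OF h] h by simp
  finally show ?thesis using \<open>real n > 0\<close> by (intro that[of n]) (simp_all add: h_def mult.commute)
qed

lemma cnorm_telescope:
  assumes N: "cnorm N" and "\<And>k. k < n \<Longrightarrow> N (f (Suc k) - f k) \<le> e"
  shows "N (f n - f 0) \<le> real n * e"
proof -
  have "f n - f 0 = (\<Sum>k<n. f (Suc k) - f k)" by (simp add: sum_lessThan_telescope)
  then have "N (f n - f 0) \<le> (\<Sum>k<n. N (f (Suc k) - f k))" using cnorm_sum[OF N] by metis
  also have "\<dots> \<le> (\<Sum>k<n. e)" by (intro sum_mono assms(2)) simp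
  finally show ?thesis by simp
qed

text \<open>Discrete form of T s x - x = integral of T r y over [0, s]: the step from kh to (k+1)h
  is T (kh) applied to T h x - x, which has norm at most h (N y + e').\<close>

lemma semigroup_increment_bound:
  assumes N: "cnorm N" and S: "C0_semigroup N T" and x: "has_generator_value N T x y"
    and C: "\<And>t x. 0 \<le> t \<Longrightarrow> t \<le> d \<Longrightarrow> N (T t x) \<le> C * N x" "C > 0"
    and s: "0 \<le> s" "s \<le> d"
  shows "N (T s x - x) \<le> C * s * N y"
proof (cases "s = 0")
  case True
  then show ?thesis using C0_semigroupD(2)[OF S] by (simp add: cnorm_zero[OF N])
next
  case False
  then have s0: "s > 0" using s by simp
  show ?thesis
  proof (rule field_le_epsilon)
    fix e :: real assume e: "e > 0"
    \<comment> \<open>Scaled so that the n step errors, each at most C e' h, add up to e.\<close>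
    define e' where "e' = e / (C * s)"
    have e': "e' > 0" using e C s0 by (simp add: e'_def)
    obtain n :: nat where n: "n > 0" "N (T (s / n) x - x - (s / n) *\<^sub>R y) \<le> e' * (s / n)"
      using has_generator_value_step[OF N x e' s0] .
    define h where "h = s / real n"
    have h: "h > 0" "h * n = s" using n s0 by (auto simp: h_def)
    have step: "N (T h x - x) \<le> h * (N y + e')"
      using cnorm_triangle_sub[OF N, of "T h x - x" "h *\<^sub>R y"] n(2) h
      by (simp add: h_def[symmetric] cnorm_scaleR[OF N] algebra_simps)
    have "N (T (real n * h) x - T (real 0 * h) x) \<le> real n * (C * (h * (N y + e')))"
    proof (rule cnorm_telescope[OF N])
      fix k assume k: "k < n"
      have kh: "0 \<le> k * h" "k * h \<le> d"
      proof -
        have "k * h \<le> n * h" using k h by (intro mult_right_mono) auto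
        then show "k * h \<le> d" using h s by (simp add: mult.commute)
      qed (use h in simp)
      have lin: "complex_linear (T (k * h))" by (rule bounded_opD(1)[OF C0_semigroupD(1)[OF S kh(1)] N])
      have "T (Suc k * h) x = T (k * h) (T h x)"
        using C0_semigroupD(3)[OF S kh(1), of h x] h by (simp add: algebra_simps)
      then have "T (Suc k * h) x - T (k * h) x = T (k * h) (T h x - x)"
        by (simp add: complex_linear_diff[OF lin])
      also have "N \<dots> \<le> C * N (T h x - x)" using kh by (rule C)
      also have "\<dots> \<le> C * (h * (N y + e'))" using step C by simp
      finally show "N (T (Suc k * h) x - T (k * h) x) \<le> C * (h * (N y + e'))" .
    qed
    moreover have "real n * (C * (h * (N y + e'))) = C * (h * n) * (N y + e')" by simp
    moreover have "real n * h = s" using h by (simp add: mult.commute)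
    ultimately have "N (T s x - x) \<le> C * s * (N y + e')"
      using C0_semigroupD(2)[OF S] h by simp
    also have "\<dots> = C * s * N y + e" using C s0 by (simp add: e'_def mult.commute field_simps)
    finally show "N (T s x - x) \<le> C * s * N y + e" .
  qed
qed

text \<open>Taylor's formula of order two, with a discrete sum in place of the integral remainder.\<close>

lemma semigroup_taylor_bound:
  assumes N: "cnorm N" and S: "C0_semigroup N T"
    and w: "has_generator_value N T w x" and x: "has_generator_value N T x v"
    and C: "\<And>t x. 0 \<le> t \<Longrightarrow> t \<le> d \<Longrightarrow> N (T t x) \<le> C * N x" "C > 0"
    and s: "0 < s" "s \<le> d"
  shows "N (T s w - w - s *\<^sub>R x) \<le> C * s\<^sup>2 * N v"
proof (rule field_le_epsilon)
  fix e :: real assume e: "e > 0"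
  define e' where "e' = e / (C * s)"
  have e': "e' > 0" using e C s by (simp add: e'_def)
  obtain n :: nat where n: "n > 0" "N (T (s / n) w - w - (s / n) *\<^sub>R x) \<le> e' * (s / n)"
    using has_generator_value_step[OF N w e' s(1)] .
  define h where "h = s / real n"
  have h: "h > 0" "h * n = s" using n s by (auto simp: h_def)
  define f where "f k = T (k * h) w - w - (k * h) *\<^sub>R x" for k :: nat
  have "N (f n - f 0) \<le> real n * (C * (e' * h) + h * (C * s * N v))"
  proof (rule cnorm_telescope[OF N])
    fix k assume k: "k < n"
    have kh: "0 \<le> k * h" "k * h \<le> s"
    proof -
      have "k * h \<le> n * h" using k h by (intro mult_right_mono) auto
      then show "k * h \<le> s" using h by (simp add: mult.commute)
    qed (use h in simp)
    have lin: "complex_linear (T (k * h))" by (rule bounded_opD(1)[OF C0_semigroupD(1)[OF S kh(1)] N])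
    have "T (Suc k * h) w = T (k * h) (T h w)"
      using C0_semigroupD(3)[OF S kh(1), of h w] h by (simp add: algebra_simps)
    \<comment> \<open>The step splits into the error of the first-order expansion of w, carried
      along by T (kh), and h times an increment of the orbit of x. Bounding kh by s in the latter
      gives the constant C where an integral would give C/2.\<close>
    then have "f (Suc k) - f k = T (k * h) (T h w - w - h *\<^sub>R x) + h *\<^sub>R (T (k * h) x - x)"
      by (simp add: f_def complex_linear_diff[OF lin] complex_linear_scaleR[OF lin]
          distrib_right scaleR_add_left scaleR_diff_right add.commute)
    also have "N \<dots> \<le> N (T (k * h) (T h w - w - h *\<^sub>R x)) + N (h *\<^sub>R (T (k * h) x - x))"
      by (rule cnorm_triangle[OF N])
    also have "N (T (k * h) (T h w - w - h *\<^sub>R x)) \<le> C * N (T h w - w - h *\<^sub>R x)"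
      using kh s by (intro C) auto
    also have "\<dots> \<le> C * (e' * h)" unfolding h_def using C(2) by (intro mult_left_mono n(2)) simp
    also have "N (h *\<^sub>R (T (k * h) x - x)) = h * N (T (k * h) x - x)"
      using h by (simp add: cnorm_scaleR[OF N])
    also have "N (T (k * h) x - x) \<le> C * (k * h) * N v"
      by (rule semigroup_increment_bound[where d = d, OF N S x]) (use C kh s in auto)
    also have "C * (k * h) * N v \<le> C * s * N v"
      using kh C cnorm_nonneg[OF N, of v] by (intro mult_right_mono mult_left_mono) auto
    finally show "N (f (Suc k) - f k) \<le> C * (e' * h) + h * (C * s * N v)" using h by simp
  qed
  moreover have "f n - f 0 = T s w - w - s *\<^sub>R x"
    using h C0_semigroupD(2)[OF S] by (simp add: f_def mult.commute)
  moreover have "real n * (C * (e' * h) + h * (C * s * N v)) = C * s\<^sup>2 * N v + e"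
  proof -
    have "real n * (C * (e' * h) + h * (C * s * N v)) = (h * n) * (C * e' + C * s * N v)"
      by (simp add: algebra_simps)
    also have "\<dots> = C * s\<^sup>2 * N v + e" unfolding h using C s by (simp add: e'_def field_simps power2_eq_square)
    finally show ?thesis .
  qed
  ultimately show "N (T s w - w - s *\<^sub>R x) \<le> C * s\<^sup>2 * N v + e" by simp
qed

section \<open>The resolvent of a generator and a bounded approximate inverse\<close>

lemma resolventD:
  assumes "\<mu> \<in> resolvent_set N D B"
  shows "resolvent D B \<mu> u \<in> D" "B (resolvent D B \<mu> u) = u + \<mu> *\<^sub>C resolvent D B \<mu> u"
    "x \<in> D \<Longrightarrow> resolvent D B \<mu> (B x - \<mu> *\<^sub>C x) = x" "bounded_op N (resolvent D B \<mu>)"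
proof -
  have b: "bij_betw (\<lambda>x. B x - \<mu> *\<^sub>C x) D UNIV" and "bounded_op N (resolvent D B \<mu>)"
    using assms by (auto simp: resolvent_set_def)
  then show "bounded_op N (resolvent D B \<mu>)" by simp
  have im: "u \<in> (\<lambda>x. B x - \<mu> *\<^sub>C x) ` D" using b by (simp add: bij_betw_def)
  show "resolvent D B \<mu> u \<in> D" unfolding resolvent_def by (rule inv_into_into[OF im])
  show "B (resolvent D B \<mu> u) = u + \<mu> *\<^sub>C resolvent D B \<mu> u"
    unfolding resolvent_def using f_inv_into_f[OF im] by (simp add: algebra_simps)
  show "x \<in> D \<Longrightarrow> resolvent D B \<mu> (B x - \<mu> *\<^sub>C x) = x"
    unfolding resolvent_def using b by (intro inv_into_f_f) (auto simp: bij_betw_def)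
qed

text \<open>A Landau-Kolmogorov inequality: \<open>\<parallel>R u\<parallel> \<le> K \<parallel>R (R u)\<parallel> + \<epsilon> \<parallel>u\<parallel>\<close>. It is stated with the operator \<open>G\<close>
  because in this form it passes to the adjoint.\<close>

lemma resolvent_landau:
  fixes N :: "'v::{complex_vector,banach} \<Rightarrow> real"
  assumes N: "cnorm N" and S: "C0_semigroup N T" and gen: "is_generator N T D B"
    and eqv: "\<And>x. norm x \<le> K1 * N x" "\<And>x. N x \<le> K2 * norm x" "K1 > 0" "K2 > 0"
    and \<mu>: "\<mu> \<in> resolvent_set N D B" and R_def: "R = resolvent D B \<mu>" and e: "e > 0"
  obtains K G where "\<And>u. N (G u) \<le> K * N u" "\<And>u. G (R (R u)) = R (R (G u))"
    "\<And>u. N (R u - G (R (R u))) \<le> e * N u"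
proof -
  note R = resolventD[OF \<mu>, folded R_def]
  have lin: "complex_linear R" by (rule bounded_opD(1)[OF R(4) N])
  obtain M where M: "M \<ge> 0" "\<And>u. N (R u) \<le> M * N u" using bounded_opD(2)[OF R(4) N] by blast
  have val: "has_generator_value N T x (B x)" if "x \<in> D" for x
    using gen that by (simp add: is_generator_def)
  have DI: "x \<in> D" "B x = y" if "has_generator_value N T x y" for x y
  proof -
    show "x \<in> D" using gen that by (auto simp: is_generator_def)
    then show "B x = y" by (intro has_generator_value_unique[OF N val that])
  qed
  \<comment> \<open>T t leaves D invariant and commutes with B there, hence with the inverse of B -
    \<mu>. This makes G commute with R.\<close>
  have comm: "R (T t u) = T t (R u)" if t: "t \<ge> 0" for t u
  proof -
    have linT: "complex_linear (T t)" by (rule bounded_opD(1)[OF C0_semigroupD(1)[OF S t] N])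
    have h: "has_generator_value N T (T t (R u)) (T t (B (R u)))"
      by (rule has_generator_value_semigroup[OF N S val[OF R(1)] t])
    have "T t u = B (T t (R u)) - \<mu> *\<^sub>C T t (R u)"
      by (simp add: DI(2)[OF h] R(2) complex_linear_add[OF linT] complex_linear_scaleC[OF linT])
    then show ?thesis using R(3)[OF DI(1)[OF h]] by simp
  qed
  obtain d C where d: "d > 0" and C: "C > 0" "\<And>t x. 0 \<le> t \<Longrightarrow> t \<le> d \<Longrightarrow> N (T t x) \<le> C * N x"
    by (rule C0_semigroup_bounded_near_0[OF N S eqv]) blast
  \<comment> \<open>The second-order term is B B w = (I + \<mu> R)^2 u, since B R = I + \<mu> R; Q
    is the square of a bound for the norm of I + \<mu> R.\<close>
  define Q where "Q = (1 + cmod \<mu> * M)\<^sup>2"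
  have Q1: "1 + cmod \<mu> * M \<ge> 1" using M by simp
  have Q: "Q > 0" using Q1 by (simp add: Q_def)
  \<comment> \<open>The Taylor error divided by t is at most C t Q times N u; t is so small that C t
    Q <= e and that the bound C applies on [0, t].\<close>
  define t where "t = min d (e / (C * Q))"
  have t: "0 < t" "t \<le> d" using d e C Q by (auto simp: t_def)
  have tC: "C * t * Q \<le> e"
  proof -
    have "t \<le> e / (C * Q)" by (simp add: t_def)
    then show ?thesis using C Q by (simp add: field_simps)
  qed
  \<comment> \<open>B - \<mu>, the inverse of R, with B replaced by its difference quotient: a
    bounded operator for which G R R approximates R.\<close>
  define G where "G u = (1 / t) *\<^sub>R (T t u - u) - \<mu> *\<^sub>C u" for u
  show ?thesis
  proof
    fix u
    have "N (G u) \<le> (1 / t) * N (T t u - u) + cmod \<mu> * N u"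
      using cnorm_triangle_diff[OF N, of "(1 / t) *\<^sub>R (T t u - u)" "\<mu> *\<^sub>C u"] t
      by (simp add: G_def cnorm_scaleC[OF N] cnorm_scaleR[OF N])
    also have "N (T t u - u) \<le> C * N u + N u"
      using cnorm_triangle_diff[OF N, of "T t u" u] C(2)[of t u] t by simp
    finally show "N (G u) \<le> ((1 / t) * (C + 1) + cmod \<mu>) * N u"
      using t by (simp add: algebra_simps add_divide_distrib divide_right_mono)
    show "G (R (R u)) = R (R (G u))"
      using t by (simp add: G_def complex_linear_diff[OF lin] complex_linear_scaleR[OF lin]
          complex_linear_scaleC[OF lin] comm)
    define x w where "x = R u" and "w = R x"
    have hx: "has_generator_value N T x (u + \<mu> *\<^sub>C x)"
      using val[OF R(1)[of u]] R(2)[of u] by (simp add: x_def)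
    have hw: "has_generator_value N T w (x + \<mu> *\<^sub>C w)"
      using val[OF R(1)[of x]] R(2)[of x] by (simp add: w_def)
    define v where "v = (u + \<mu> *\<^sub>C x) + \<mu> *\<^sub>C (x + \<mu> *\<^sub>C w)"
    have hv: "has_generator_value N T (x + \<mu> *\<^sub>C w) v"
      unfolding v_def by (rule has_generator_value_add_scaleC[OF N S hx hw])
    have Nx: "N (y + \<mu> *\<^sub>C R y) \<le> (1 + cmod \<mu> * M) * N y" for y
    proof -
      have "N (y + \<mu> *\<^sub>C R y) \<le> N y + cmod \<mu> * N (R y)"
        using cnorm_triangle[OF N, of y "\<mu> *\<^sub>C R y"] by (simp add: cnorm_scaleC[OF N])
      also have "\<dots> \<le> N y + cmod \<mu> * (M * N y)" using M by (simp add: mult_left_mono)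
      finally show ?thesis by (simp add: algebra_simps)
    qed
    have "v = (u + \<mu> *\<^sub>C R u) + \<mu> *\<^sub>C R (u + \<mu> *\<^sub>C R u)"
      by (simp add: v_def x_def w_def complex_linear_add[OF lin] complex_linear_scaleC[OF lin])
    then have "N v \<le> (1 + cmod \<mu> * M) * N (u + \<mu> *\<^sub>C R u)" using Nx by simp
    also have "\<dots> \<le> (1 + cmod \<mu> * M) * ((1 + cmod \<mu> * M) * N u)"
      using Nx[of u] Q1 by (intro mult_left_mono) auto
    finally have Nv: "N v \<le> Q * N u" by (simp add: Q_def power2_eq_square mult_ac)
    \<comment> \<open>Here x + \<mu> w = B w, so the \<mu>-terms cancel and only the second-order
      Taylor error of w, divided by t, remains.\<close>
    have "x - G w = - ((1 / t) *\<^sub>R (T t w - w - t *\<^sub>R (x + \<mu> *\<^sub>C w)))"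
      using t by (simp add: G_def algebra_simps)
    then have "N (x - G w) = (1 / t) * N (T t w - w - t *\<^sub>R (x + \<mu> *\<^sub>C w))"
      using t by (simp add: cnorm_minus[OF N] cnorm_scaleR[OF N] del: scaleR_add_right)
    also have "\<dots> \<le> (1 / t) * (C * t\<^sup>2 * N v)"
    proof (rule mult_left_mono)
      show "N (T t w - w - t *\<^sub>R (x + \<mu> *\<^sub>C w)) \<le> C * t\<^sup>2 * N v"
        by (rule semigroup_taylor_bound[where d = d, OF N S hw hv]) (use C t in auto)
    qed (use t in simp)
    also have "\<dots> = C * t * N v" using t by (simp add: power2_eq_square)
    also have "\<dots> \<le> C * t * (Q * N u)" using Nv C t by (intro mult_left_mono) auto
    also have "\<dots> = (C * t * Q) * N u" by simp
    also have "\<dots> \<le> e * N u" using tC cnorm_nonneg[OF N, of u] by (intro mult_right_mono) auto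
    finally show "N (R u - G (R (R u))) \<le> e * N u" by (simp add: x_def w_def)
  qed
qed

section \<open>Fejer averages of the resolvent\<close>

lemma Re_of_real_mult: "Re (of_real r * z) = r * Re z"
  by simp

lemma complex_rotation:
  obtains s where "cmod s = 1" "s * w = of_real (cmod w)"
proof (cases "w = 0")
  case True
  then show ?thesis by (intro that[of 1]) simp_all
next
  case False
  have sq: "cnj w * w = of_real (cmod w) * of_real (cmod w)"
    using complex_norm_square[of w] by (simp add: power2_eq_square mult.commute)
  show ?thesis
  proof (rule that[of "cnj w / of_real (cmod w)"])
    show "cnj w / of_real (cmod w) * w = of_real (cmod w)" using False by (simp add: sq)
  qed (use False in \<open>simp add: norm_divide\<close>)
qed

text \<open>A geometric sum whose ratio q satisfies q^n = 1 vanishes unless q = 1, that is, unless n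
  divides k.\<close>

lemma sum_roots_unity_power:
  assumes "n > 0"
  shows "(\<Sum>j<n. cis (2 * pi * real_of_int k * real j / real n))
    = (if int n dvd k then of_nat n else 0)"
proof -
  define q where "q = cis (2 * pi * real_of_int k / real n)"
  have pw: "cis (2 * pi * real_of_int k * real j / real n) = q ^ j" for j
    unfolding q_def Complex.DeMoivre by (rule arg_cong[where f = cis]) simp
  have one: "q ^ n = 1"
    using assms cis_multiple_2pi[of "of_int k"] by (simp add: q_def Complex.DeMoivre mult.assoc)
  have "q = 1 \<longleftrightarrow> int n dvd k"
  proof
    assume "q = 1"
    then have "cos (2 * pi * real_of_int k / real n) = 1" by (simp add: q_def complex_eq_iff)
    then obtain m where "2 * pi * real_of_int k / real n = of_int m * 2 * pi"
      using cos_one_2pi_int by auto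
    then have "real_of_int k = of_int (m * int n)" using assms by (simp add: field_simps)
    then have "k = m * int n" by (simp only: of_int_eq_iff)
    then show "int n dvd k" by simp
  next
    assume "int n dvd k"
    then obtain m where "k = int n * m" by (auto elim: dvdE)
    then have "q = cis (2 * pi * of_int m)" using assms by (simp add: q_def field_simps)
    then show "q = 1" by (simp add: cis_multiple_2pi)
  qed
  then show ?thesis
    using one geometric_sum[of q n] by (auto simp: pw)
qed

text \<open>The weights are those of the Fejer kernel \<open>1 + cos (m\<theta> + \<phi>)\<close>, sampled at the \<open>l\<close>-th roots
  of unity.\<close>

lemma fejer_polynomial:
  fixes v :: "nat \<Rightarrow> 'v::complex_vector"
  assumes N: "cnorm N" and m: "0 < m" and n: "n + m \<le> l" "m < n"
    and bnd: "\<And>z. cmod z = 1 \<Longrightarrow> N (\<Sum>k<n. (z ^ k) *\<^sub>C v k) \<le> K"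
    and z: "cmod z = 1"
  shows "N (v 0 + (z / 2) *\<^sub>C v m) \<le> K"
proof -
  define w where "w j = cis (2 * pi * real j / real l)" for j
  have l: "l > 0" using m n by simp
  have nw: "cmod (w j) = 1" for j by (simp add: w_def)
  define g where "g j = 1 + Re (z * cnj (w j ^ m))" for j
  have g0: "g j \<ge> 0" for j
  proof -
    have "\<bar>Re (z * cnj (w j ^ m))\<bar> \<le> cmod (z * cnj (w j ^ m))" by (rule abs_Re_le_cmod)
    also have "\<dots> = 1" using z nw by (simp add: norm_mult norm_power)
    finally show ?thesis by (simp add: g_def)
  qed
  have cg: "complex_of_real (g j) = 1 + z / 2 * cnj (w j) ^ m + cnj z / 2 * w j ^ m" for j
  proof -
    have "complex_of_real (Re u) = (u + cnj u) / 2" for u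
      using complex_add_cnj[of u] by simp
    then have "complex_of_real (Re (z * cnj (w j ^ m))) = (z * cnj (w j) ^ m + cnj z * w j ^ m) / 2"
      by (simp only: complex_cnj_mult complex_cnj_power complex_cnj_cnj)
    then show ?thesis unfolding g_def of_real_add of_real_1 by (simp only:) (simp add: field_simps)
  qed
  have S: "(\<Sum>j<l. w j ^ a * cnj (w j) ^ b) = (if int l dvd int a - int b then of_nat l else 0)" for a b
  proof -
    have "w j ^ a * cnj (w j) ^ b = cis (2 * pi * real_of_int (int a - int b) * real j / real l)" for j
      unfolding w_def cis_cnj Complex.DeMoivre cis_mult
      by (rule arg_cong[where f = cis]) (simp add: diff_divide_distrib algebra_simps)
    then show ?thesis using sum_roots_unity_power[OF l, of "int a - int b"] by simp
  qed
  have dv: "int l dvd d \<longleftrightarrow> d = 0" if "\<bar>d\<bar> < int l" for d :: int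
    using that dvd_imp_le_int[of d "int l"] by auto
  \<comment> \<open>The kernel contributes the exponents k, k - m and k + m. As k + m < n + m <= l,
    all lie strictly between -l and l, so the discrete averages have no aliasing; k + m is positive
    and contributes nothing.\<close>
  have cf: "(\<Sum>j<l. of_real (g j) * w j ^ k) = of_nat l * ((if k = 0 then 1 else 0) + (if k = m then z / 2 else 0))"
    if "k < n" for k
  proof -
    have "(\<Sum>j<l. of_real (g j) * w j ^ k)
      = (\<Sum>j<l. w j ^ k * cnj (w j) ^ 0) + z / 2 * (\<Sum>j<l. w j ^ k * cnj (w j) ^ m)
        + cnj z / 2 * (\<Sum>j<l. w j ^ (k + m) * cnj (w j) ^ 0)"
      unfolding sum_distrib_left sum.distrib[symmetric]
      by (rule sum.cong) (simp_all add: cg algebra_simps power_add)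
    then show ?thesis unfolding S using that n m by (auto simp: dv dest: dvd_imp_le)
  qed
  have gs: "(\<Sum>j<l. g j) = real l"
  proof -
    have "complex_of_real (\<Sum>j<l. g j) = complex_of_real (real l)"
      using cf[of 0] m n by simp
    then show ?thesis by (simp only: of_real_eq_iff)
  qed
  have "(\<Sum>j<l. of_real (g j) *\<^sub>C (\<Sum>k<n. (w j ^ k) *\<^sub>C v k))
      = (\<Sum>k<n. (\<Sum>j<l. of_real (g j) * w j ^ k) *\<^sub>C v k)"
    by (simp add: scaleC_sum_right scaleC_sum_left scaleC_scaleC sum.swap[of _ "{..<n}"])
  also have "\<dots> = (\<Sum>k<n. if k = 0 then of_nat l *\<^sub>C v 0 else 0)
      + (\<Sum>k<n. if k = m then (of_nat l * (z / 2)) *\<^sub>C v m else 0)"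
    unfolding sum.distrib[symmetric] using m by (intro sum.cong) (auto simp: cf)
  also have "\<dots> = of_nat l *\<^sub>C (v 0 + (z / 2) *\<^sub>C v m)"
    using n m by (simp add: scaleC_add_right scaleC_scaleC)
  finally have eq: "of_nat l *\<^sub>C (v 0 + (z / 2) *\<^sub>C v m)
      = (\<Sum>j<l. of_real (g j) *\<^sub>C (\<Sum>k<n. (w j ^ k) *\<^sub>C v k))" ..
  have "real l * N (v 0 + (z / 2) *\<^sub>C v m) = N (\<Sum>j<l. of_real (g j) *\<^sub>C (\<Sum>k<n. (w j ^ k) *\<^sub>C v k))"
    unfolding eq[symmetric] by (simp add: cnorm_scaleC[OF N])
  also have "\<dots> \<le> (\<Sum>j<l. N (of_real (g j) *\<^sub>C (\<Sum>k<n. (w j ^ k) *\<^sub>C v k)))"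
    by (rule cnorm_sum[OF N])
  also have "\<dots> \<le> (\<Sum>j<l. g j * K)"
    using g0 bnd nw by (intro sum_mono) (simp add: cnorm_scaleC[OF N] mult_left_mono)
  also have "\<dots> = real l * K" by (simp add: gs flip: sum_distrib_right)
  finally show ?thesis using l by simp
qed

text \<open>A point z = r e of the disc lies on the diameter from -e to e, so a + z b is the convex
  combination of the values at e and -e with weights (1 + r)/2 and (1 - r)/2.\<close>

lemma cnorm_disc_of_circle:
  assumes N: "cnorm N" and circ: "\<And>z. cmod z = 1 \<Longrightarrow> N (a + z *\<^sub>C b) \<le> K" and z: "cmod z \<le> 1"
  shows "N (a + z *\<^sub>C b) \<le> K"
proof -
  define e where "e = (if z = 0 then 1 else sgn z)"
  have e: "cmod e = 1" "z = of_real (cmod z) * e"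
    by (auto simp: e_def sgn_eq norm_divide)
  define r where "r = cmod z"
  have "of_real ((1 + r) / 2) *\<^sub>C (a + e *\<^sub>C b) + of_real ((1 - r) / 2) *\<^sub>C (a + (- e) *\<^sub>C b)
      = (of_real ((1 + r) / 2) + of_real ((1 - r) / 2)) *\<^sub>C a
        + (of_real ((1 + r) / 2) * e + of_real ((1 - r) / 2) * (- e)) *\<^sub>C b"
    unfolding scaleC_add_right scaleC_add_left scaleC_scaleC by (simp add: algebra_simps)
  also have "of_real ((1 + r) / 2) + of_real ((1 - r) / 2) = (1::complex)"
    by (simp add: complex_eq_iff field_simps)
  also have "of_real ((1 + r) / 2) * e + of_real ((1 - r) / 2) * (- e) = z"
    by (subst e(2)) (simp add: r_def field_simps)
  finally have eq: "a + z *\<^sub>C b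
      = of_real ((1 + r) / 2) *\<^sub>C (a + e *\<^sub>C b) + of_real ((1 - r) / 2) *\<^sub>C (a + (- e) *\<^sub>C b)" by simp
  have r: "0 \<le> r" "r \<le> 1" using z by (auto simp: r_def)
  have "N (a + z *\<^sub>C b) \<le> (1 + r) / 2 * N (a + e *\<^sub>C b) + (1 - r) / 2 * N (a + (- e) *\<^sub>C b)"
    unfolding eq by (rule order_trans[OF cnorm_triangle[OF N]])
      (use r in \<open>simp only: cnorm_scaleC[OF N] norm_of_real, simp\<close>)
  also have "\<dots> \<le> (1 + r) / 2 * K + (1 - r) / 2 * K"
    using r circ[of e] circ[of "- e"] e(1) by (intro add_mono mult_left_mono) auto
  also have "\<dots> = K" by (simp add: field_simps)
  finally show ?thesis .
qed

text \<open>On the circle of radius p about \<mu> the resolvent, bounded by M, is a Neumann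
  polynomial in R up to a remainder of relative size (pM)^n. The Fejer average extracts the
  coefficients of orders 0 and m under the same bound, and the remainder disappears as n
  grows.\<close>

lemma resolvent_fejer:
  assumes N: "cnorm N" and \<Omega>: "open \<Omega>" "\<mu> \<in> \<Omega>"
    and res: "\<And>\<nu>. \<nu> \<in> \<Omega> \<Longrightarrow> \<nu> \<in> resolvent_set N D B"
    and bnd: "\<And>\<nu> u. \<nu> \<in> \<Omega> \<Longrightarrow> N (resolvent D B \<nu> u) \<le> M * N u"
    and R_def: "R = resolvent D B \<mu>" and m: "m > 0" and M: "M > 0"
  obtains c where "c > 0" "\<And>z u. cmod z \<le> 1 \<Longrightarrow> N (R u + (z * of_real c) *\<^sub>C (R ^^ (m + 1)) u) \<le> M * N u"
proof -
  have lin: "complex_linear R"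
    using bounded_opD(1)[OF resolventD(4)[OF res[OF \<Omega>(2)]] N] by (simp add: R_def)
  obtain r where r: "r > 0" "cball \<mu> r \<subseteq> \<Omega>" using \<Omega> by (auto simp: open_contains_cball)
  \<comment> \<open>The circle has to stay in \<Omega>, and pM <= 1/2 makes the Neumann remainder
    tend to 0.\<close>
  define p where "p = min r (1 / (2 * M))"
  have p: "p > 0" "p \<le> r" using r M by (auto simp: p_def)
  have pM: "p * M \<le> 1 / 2"
  proof -
    have "p \<le> 1 / (2 * M)" by (simp add: p_def)
    then show ?thesis using M by (simp add: field_simps)
  qed
  have Rn: "N ((R ^^ n) u) \<le> M ^ n * N u" for n u
  proof (induction n)
    case (Suc n)
    have "N ((R ^^ Suc n) u) \<le> M * N ((R ^^ n) u)" using bnd[OF \<Omega>(2)] by (simp add: R_def)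
    also have "\<dots> \<le> M * (M ^ n * N u)" using Suc M by simp
    finally show ?case by (simp add: mult_ac)
  qed simp
  have poly: "N (\<Sum>k<n. (z ^ k) *\<^sub>C of_real (p ^ k) *\<^sub>C (R ^^ Suc k) u) \<le> (1 + (1/2) ^ n) * (M * N u)"
    if z: "cmod z = 1" for z n u
  proof -
    define \<zeta> where "\<zeta> = of_real p * z"
    define \<nu> where "\<nu> = \<mu> + \<zeta>"
    define y where "y = resolvent D B \<nu> u"
    have \<nu>: "\<nu> \<in> \<Omega>" using r p z by (intro subsetD[OF r(2)]) (simp add: \<nu>_def \<zeta>_def dist_norm norm_mult)
    \<comment> \<open>The resolvent inverts B - \<nu>, not \<nu> - B, so the resolvent identity
      carries a plus sign and the expansion has no alternating signs.\<close>
    have y: "y = R u + \<zeta> *\<^sub>C R y"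
    proof -
      have "y \<in> D" "B y = u + \<nu> *\<^sub>C y" using resolventD[OF res[OF \<nu>]] by (auto simp: y_def)
      then have "R (u + \<zeta> *\<^sub>C y) = y"
        using resolventD(3)[OF res[OF \<Omega>(2)], of y] by (simp add: R_def \<nu>_def scaleC_add_left)
      then show ?thesis by (simp add: complex_linear_add[OF lin] complex_linear_scaleC[OF lin])
    qed
    \<comment> \<open>Iterating the identity is exact, so the remainder is estimated through N y and
      no infinite series has to be summed.\<close>
    have exp: "y = (\<Sum>k<n. (\<zeta> ^ k) *\<^sub>C (R ^^ Suc k) u) + (\<zeta> ^ n) *\<^sub>C (R ^^ n) y" for n
    proof (induction n)
      case (Suc n)
      have "(R ^^ n) y = (R ^^ n) (R u + \<zeta> *\<^sub>C R y)" using y by simp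
      also have "\<dots> = (R ^^ Suc n) u + \<zeta> *\<^sub>C (R ^^ Suc n) y"
        using complex_linear_funpow[OF lin, of n]
        by (simp add: complex_linear_add complex_linear_scaleC funpow_swap1)
      finally have eq: "(R ^^ n) y = (R ^^ Suc n) u + \<zeta> *\<^sub>C (R ^^ Suc n) y" .
      have "y = (\<Sum>k<n. (\<zeta> ^ k) *\<^sub>C (R ^^ Suc k) u) + (\<zeta> ^ n) *\<^sub>C (R ^^ n) y" by (rule Suc)
      also have "\<dots> = (\<Sum>k<Suc n. (\<zeta> ^ k) *\<^sub>C (R ^^ Suc k) u) + (\<zeta> ^ Suc n) *\<^sub>C (R ^^ Suc n) y"
        by (simp only: eq scaleC_add_right scaleC_scaleC power_Suc2 sum.lessThan_Suc add.assoc)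
      finally show ?case .
    qed simp
    have "(\<Sum>k<n. (z ^ k) *\<^sub>C of_real (p ^ k) *\<^sub>C (R ^^ Suc k) u) = (\<Sum>k<n. (\<zeta> ^ k) *\<^sub>C (R ^^ Suc k) u)"
      by (simp add: scaleC_scaleC \<zeta>_def power_mult_distrib mult.commute)
    also have "\<dots> = y - (\<zeta> ^ n) *\<^sub>C (R ^^ n) y" using exp[of n] by (simp add: algebra_simps)
    finally have "N (\<Sum>k<n. (z ^ k) *\<^sub>C of_real (p ^ k) *\<^sub>C (R ^^ Suc k) u)
        \<le> N y + p ^ n * N ((R ^^ n) y)"
      using cnorm_triangle_diff[OF N, of y "(\<zeta> ^ n) *\<^sub>C (R ^^ n) y"] z p
      by (simp add: cnorm_scaleC[OF N] norm_power \<zeta>_def norm_mult)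
    also have "\<dots> \<le> N y + p ^ n * (M ^ n * N y)" using Rn[of n y] p by simp
    also have "\<dots> = (1 + (p * M) ^ n) * N y" by (simp add: power_mult_distrib algebra_simps)
    also have "\<dots> \<le> (1 + (1/2) ^ n) * N y"
      using pM p M cnorm_nonneg[OF N, of y] by (intro mult_right_mono add_left_mono power_mono) auto
    also have "\<dots> \<le> (1 + (1/2) ^ n) * (M * N u)"
      unfolding y_def by (intro mult_left_mono bnd \<nu>) auto
    finally show ?thesis .
  qed
  \<comment> \<open>The radius contributes p^m; 1/2 is the coefficient of the Fejer kernel at order
    m.\<close>
  define c where "c = p ^ m / 2"
  have "N (R u + (z * of_real c) *\<^sub>C (R ^^ (m + 1)) u) \<le> M * N u" if z: "cmod z = 1" for z u
  proof (rule tendsto_lowerbound)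
    show "(\<lambda>n. (1 + (1/2) ^ n) * (M * N u)) \<longlonglongrightarrow> M * N u"
      by (rule tendsto_eq_intros LIMSEQ_power_zero | simp)+
    have "N (R u + (z * of_real c) *\<^sub>C (R ^^ (m + 1)) u) \<le> (1 + (1/2) ^ n) * (M * N u)" if n: "n > m" for n
      using fejer_polynomial[OF N m order_refl n poly z, of u]
      by (simp add: c_def scaleC_scaleC)
    then show "\<forall>\<^sub>F n in sequentially. N (R u + (z * of_real c) *\<^sub>C (R ^^ (m + 1)) u) \<le> (1 + (1/2) ^ n) * (M * N u)"
      by (auto simp: eventually_sequentially intro!: exI[of _ "Suc m"])
  qed simp
  then have "N (R u + z *\<^sub>C of_real c *\<^sub>C (R ^^ (m + 1)) u) \<le> M * N u" if "cmod z \<le> 1" for z u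
    by - (rule cnorm_disc_of_circle[OF N _ that], simp add: scaleC_scaleC)
  then show ?thesis using p by (intro that[of c]) (simp_all add: c_def scaleC_scaleC)
qed

section \<open>Absolute norms and complex uniform convexity\<close>

text \<open>Absolute norms of the plane, seen on the closed first quadrant. Monotonicity follows
  from subadditivity and the two lower bounds. The class is closed under duality, so the results
  hold for the \<psi>-norm and for its dual alike.\<close>

locale absolute_norm =
  fixes \<nu> :: "real \<Rightarrow> real \<Rightarrow> real"
  assumes subadd: "\<lbrakk>0 \<le> a; 0 \<le> b; 0 \<le> a'; 0 \<le> b'\<rbrakk> \<Longrightarrow> \<nu> (a + a') (b + b') \<le> \<nu> a b + \<nu> a' b'"
    and homogeneous: "\<lbrakk>0 \<le> r; 0 \<le> a; 0 \<le> b\<rbrakk> \<Longrightarrow> \<nu> (r * a) (r * b) = r * \<nu> a b"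
    and left_0: "0 \<le> a \<Longrightarrow> \<nu> a 0 = a" and right_0: "0 \<le> b \<Longrightarrow> \<nu> 0 b = b"
    and ge_left: "\<lbrakk>0 \<le> a; 0 \<le> b\<rbrakk> \<Longrightarrow> a \<le> \<nu> a b" and ge_right: "\<lbrakk>0 \<le> a; 0 \<le> b\<rbrakk> \<Longrightarrow> b \<le> \<nu> a b"
begin

text \<open>With r = a/a' the point (a, b) is r (a', b) + (1 - r) (0, b), and the value b of \<nu>
  at (0, b) is at most its value at (a', b) by \<open>ge_right\<close>.\<close>

lemma mono_left:
  assumes "0 \<le> a" "a \<le> a'" "0 \<le> b" shows "\<nu> a b \<le> \<nu> a' b"
proof (cases "a' = 0")
  case True
  then show ?thesis using assms by simp
next
  case False
  define r where "r = a / a'"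
  have a': "a' > 0" using False assms by simp
  have r: "0 \<le> r" "r \<le> 1" "r * a' = a" using a' assms by (auto simp: r_def)
  have "\<nu> a b = \<nu> (r * a' + 0) (r * b + (1 - r) * b)" using r by (simp add: algebra_simps)
  also have "\<dots> \<le> \<nu> (r * a') (r * b) + \<nu> 0 ((1 - r) * b)"
    using r a' assms by (intro subadd) auto
  also have "\<dots> = r * \<nu> a' b + (1 - r) * b"
    using r a' assms homogeneous[of r a' b] right_0[of "(1 - r) * b"] by simp
  also have "\<dots> \<le> r * \<nu> a' b + (1 - r) * \<nu> a' b"
    using r a' assms ge_right[of a' b] by (intro add_left_mono mult_left_mono) auto
  finally show ?thesis by (simp add: algebra_simps)
qed

lemma mono_right:
  assumes "0 \<le> a" "0 \<le> b" "b \<le> b'" shows "\<nu> a b \<le> \<nu> a b'"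
proof (cases "b' = 0")
  case True
  then show ?thesis using assms by simp
next
  case False
  define r where "r = b / b'"
  have b': "b' > 0" using False assms by simp
  have r: "0 \<le> r" "r \<le> 1" "r * b' = b" using b' assms by (auto simp: r_def)
  have "\<nu> a b = \<nu> (r * a + (1 - r) * a) (r * b' + 0)" using r by (simp add: algebra_simps)
  also have "\<dots> \<le> \<nu> (r * a) (r * b') + \<nu> ((1 - r) * a) 0"
    using r b' assms by (intro subadd) auto
  also have "\<dots> = r * \<nu> a b' + (1 - r) * a"
    using r b' assms homogeneous[of r a b'] left_0[of "(1 - r) * a"] by simp
  also have "\<dots> \<le> r * \<nu> a b' + (1 - r) * \<nu> a b'"
    using r b' assms ge_left[of a b'] by (intro add_left_mono mult_left_mono) auto
  finally show ?thesis by (simp add: algebra_simps)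
qed

lemma mono: "\<lbrakk>0 \<le> a; a \<le> a'; 0 \<le> b; b \<le> b'\<rbrakk> \<Longrightarrow> \<nu> a b \<le> \<nu> a' b'"
  using mono_left[of a a' b] mono_right[of a' b b'] by simp

lemma le_add: "\<lbrakk>0 \<le> a; 0 \<le> b\<rbrakk> \<Longrightarrow> \<nu> a b \<le> a + b"
  using subadd[of a 0 0 b] left_0[of a] right_0[of b] by simp

lemma diff_right: "\<lbrakk>0 \<le> a; 0 \<le> b; b \<le> b'\<rbrakk> \<Longrightarrow> \<nu> a b' \<le> \<nu> a b + (b' - b)"
  using subadd[of a b 0 "b' - b"] right_0[of "b' - b"] by simp

text \<open>Absolute values extend \<nu> to a sublinear functional on the whole plane; a Hahn-Banach
  functional attaining it at (a, b) has two real coefficients, possibly negative.\<close>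

lemma support:
  obtains l1 l2 where "l1 * a + l2 * b = \<nu> \<bar>a\<bar> \<bar>b\<bar>" "\<And>s t. l1 * s + l2 * t \<le> \<nu> \<bar>s\<bar> \<bar>t\<bar>"
proof -
  define p where "p x = \<nu> \<bar>fst x\<bar> \<bar>snd x\<bar>" for x :: "real \<times> real"
  have "sublin p"
    unfolding sublin_def
  proof safe
    fix x y :: "real \<times> real" and r :: real
    have "p (x + y) \<le> \<nu> (\<bar>fst x\<bar> + \<bar>fst y\<bar>) (\<bar>snd x\<bar> + \<bar>snd y\<bar>)"
      unfolding p_def by (rule mono) auto
    also have "\<dots> \<le> p x + p y" unfolding p_def by (rule subadd) auto
    finally show "p (x + y) \<le> p x + p y" .
    show "r \<ge> 0 \<Longrightarrow> p (r *\<^sub>R x) = r * p x" by (simp add: p_def abs_mult homogeneous)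
  qed
  then obtain f where f: "linear f" "\<And>x. f x \<le> p x" "f (a, b) = p (a, b)"
    by (rule hahn_banach[where ?x0.0 = "(a, b)"]) blast
  have lin_f: "f (s, t) = f (1, 0) * s + f (0, 1) * t" for s t
  proof -
    have "f (s *\<^sub>R (1, 0) + t *\<^sub>R (0, 1)) = s *\<^sub>R f (1, 0) + t *\<^sub>R f (0, 1)"
      using f(1) by (simp only: linear_add linear_scale)
    then show ?thesis by (simp add: mult.commute)
  qed
  show ?thesis
  proof (rule that)
    show "f (1, 0) * a + f (0, 1) * b = \<nu> \<bar>a\<bar> \<bar>b\<bar>" unfolding lin_f[symmetric] f(3) by (simp add: p_def)
    show "f (1, 0) * s + f (0, 1) * t \<le> \<nu> \<bar>s\<bar> \<bar>t\<bar>" for s t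
      unfolding lin_f[symmetric] using f(2)[of "(s, t)"] by (simp add: p_def)
  qed
qed

definition sum_norm :: "'z::complex_normed_vector \<times> complex \<Rightarrow> real"
  where "sum_norm x = \<nu> (norm (fst x)) (norm (snd x))"

lemma sum_norm_ge: "norm (fst x) \<le> sum_norm x" "norm (snd x) \<le> sum_norm x"
  by (simp_all add: sum_norm_def ge_left ge_right)

lemma sum_norm_le: "sum_norm x \<le> norm (fst x) + norm (snd x)"
  by (simp add: sum_norm_def le_add)

lemma cnorm_sum_norm: "cnorm (sum_norm :: 'z::complex_normed_vector \<times> complex \<Rightarrow> real)"
  unfolding cnorm_def
proof safe
  fix x y :: "'z \<times> complex" and a
  have "sum_norm (x + y) \<le> \<nu> (norm (fst x) + norm (fst y)) (norm (snd x) + norm (snd y))"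
    unfolding sum_norm_def by (rule mono) (auto simp: norm_triangle_ineq)
  also have "\<dots> \<le> sum_norm x + sum_norm y" unfolding sum_norm_def by (rule subadd) auto
  finally show "sum_norm (x + y) \<le> sum_norm x + sum_norm y" .
  show "sum_norm (a *\<^sub>C x) = cmod a * sum_norm x"
    by (simp add: sum_norm_def scaleC_prod_def norm_scaleC homogeneous)
next
  fix a :: 'z and b assume "sum_norm (a, b) = 0"
  then show "(a, b) = 0" using sum_norm_ge[of "(a, b)"] by (simp add: prod_eq_iff)
qed

end

text \<open>The bound \<open>1 + Re (\<zeta>q)\<close> is at most \<open>cmod (1 + \<zeta>q)\<close>, and the substitution \<open>\<xi> = \<zeta> / (1 + \<zeta>q)\<close> turns
  \<open>(a + \<zeta>c) / (1 + \<zeta>q)\<close> into \<open>a + \<xi>(c - qa)\<close>, to which complex uniform convexity applies.\<close>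

lemma complex_uniformly_convex_affine_bound:
  assumes cuc: "complex_uniformly_convex TYPE('z::complex_banach)" and Q: "Q > 0" and e: "e > 0"
  obtains d where "d > 0" "\<And>a c :: 'z. \<And>q. cmod q \<le> Q \<Longrightarrow>
    (\<And>\<zeta>. cmod \<zeta> \<le> 1 \<Longrightarrow> norm (a + \<zeta> *\<^sub>C c) \<le> 1 + Re (\<zeta> * q)) \<Longrightarrow> norm a \<ge> 1 - d \<Longrightarrow> norm c \<le> e"
proof -
  \<comment> \<open>e1 <= e/2 serves the bound on y. The estimate of q below ends in |q|^2 <= 16 e1,
    which explains the 64.\<close>
  define e1 where "e1 = min (1/2) (min (e / 2) (e\<^sup>2 / 64))"
  have e1: "e1 > 0" "e1 \<le> 1/2" "e1 \<le> e / 2" "16 * e1 \<le> (e / 2)\<^sup>2"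
    using e by (auto simp: e1_def power_divide)
  obtain d1 where d1: "d1 > 0" and conv: "\<And>x y :: 'z. norm y \<ge> e1 / (1 + Q) \<Longrightarrow>
      (\<forall>\<zeta>. cmod \<zeta> \<le> 1 \<longrightarrow> norm (x + \<zeta> *\<^sub>C y) \<le> 1) \<Longrightarrow> norm x \<le> 1 - d1"
    using cuc e1 Q unfolding complex_uniformly_convex_def by (metis add_pos_pos divide_pos_pos zero_less_one)
  define d where "d = min (d1 / 2) e1"
  have d: "d > 0" "d < d1" "d \<le> e1" using d1 e1 by (auto simp: d_def)
  have "norm c \<le> e" if q: "cmod q \<le> Q"
    and bnd: "\<And>\<zeta>. cmod \<zeta> \<le> 1 \<Longrightarrow> norm (a + \<zeta> *\<^sub>C c) \<le> 1 + Re (\<zeta> * q)" and a: "norm a \<ge> 1 - d"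
    for a c :: 'z and q
  proof -
    define y where "y = c - q *\<^sub>C a"
    \<comment> \<open>For |\<xi>| <= 1/(1 + Q) the substitution \<zeta> = \<xi>/(1 - q \<xi>) stays
      in the unit disc. Convexity is later applied to y/(1 + Q), which brings this disc to unit
      size.\<close>
    have disc: "norm (a + \<xi> *\<^sub>C y) \<le> 1" if \<xi>: "cmod \<xi> \<le> 1 / (1 + Q)" for \<xi>
    proof -
      have \<xi>': "cmod \<xi> + Q * cmod \<xi> \<le> 1" using \<xi> Q by (simp add: field_simps)
      have q\<xi>: "cmod (q * \<xi>) \<le> Q * cmod \<xi>" using q by (simp add: norm_mult mult_right_mono)
      have ge: "cmod \<xi> \<le> cmod (1 - q * \<xi>)"
        using norm_triangle_ineq2[of 1 "q * \<xi>"] q\<xi> \<xi>' by simp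
      have nz: "1 - q * \<xi> \<noteq> 0"
      proof
        assume "1 - q * \<xi> = 0"
        then have "\<xi> = 0" using ge by simp
        then show False using \<open>1 - q * \<xi> = 0\<close> by simp
      qed
      define \<zeta> where "\<zeta> = \<xi> / (1 - q * \<xi>)"
      have \<zeta>: "cmod \<zeta> \<le> 1" using ge nz by (simp add: \<zeta>_def norm_divide divide_le_eq)
      have m: "(1 - q * \<xi>) * \<zeta> = \<xi>" using nz by (simp add: \<zeta>_def)
      have "a + \<xi> *\<^sub>C y = (1 - q * \<xi>) *\<^sub>C (a + \<zeta> *\<^sub>C c)"
        unfolding scaleC_add_right scaleC_scaleC m y_def
        using scaleC_add_left[of 1 "- (q * \<xi>)" a]
        by (simp add: scaleC_diff_right scaleC_scaleC mult.commute)
      then have "norm (a + \<xi> *\<^sub>C y) = cmod (1 - q * \<xi>) * norm (a + \<zeta> *\<^sub>C c)" by (simp add: norm_scaleC)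
      also have "\<dots> \<le> cmod (1 - q * \<xi>) * cmod (1 + \<zeta> * q)"
        using bnd[OF \<zeta>] complex_Re_le_cmod[of "1 + \<zeta> * q"] by (intro mult_left_mono) auto
      also have "\<dots> = cmod ((1 - q * \<xi>) + (1 - q * \<xi>) * \<zeta> * q)"
        by (simp add: norm_mult[symmetric] algebra_simps)
      also have "\<dots> = 1" unfolding m by (simp add: mult.commute)
      finally show ?thesis .
    qed
    have "norm y < e1"
    proof (rule ccontr)
      assume "\<not> norm y < e1"
      then have "norm (of_real (1 / (1 + Q)) *\<^sub>C y) \<ge> e1 / (1 + Q)"
        using Q by (simp only: norm_scaleC norm_of_real) (simp add: divide_right_mono)
      moreover have "norm (a + \<zeta> *\<^sub>C of_real (1 / (1 + Q)) *\<^sub>C y) \<le> 1" if "cmod \<zeta> \<le> 1" for \<zeta>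
        unfolding scaleC_scaleC using that Q
        by (intro disc) (simp only: norm_mult norm_of_real, simp add: divide_right_mono)
      ultimately have "norm a \<le> 1 - d1" by (intro conv) auto
      then show False using a d by simp
    qed
    have a1: "norm a \<le> 1" using bnd[of 0] by simp
    \<comment> \<open>Smallness of y only says that c is close to q a. To see that q is small,
      \<zeta> q is rotated onto the imaginary axis: the affine bound is then 1, while (1 + i |q|) a
      has norm sqrt (1 + |q|^2) times that of a.\<close>
    have "(cmod q)\<^sup>2 \<le> (e / 2)\<^sup>2"
    proof (cases "q = 0")
      case False
      obtain s where s: "cmod s = 1" "s * q = of_real (cmod q)" by (rule complex_rotation)
      define \<zeta> where "\<zeta> = \<i> * s"
      have \<zeta>: "cmod \<zeta> = 1" "\<zeta> * q = \<i> * of_real (cmod q)"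
        using s by (simp_all add: \<zeta>_def norm_mult)
      have "a + \<zeta> *\<^sub>C c = (1 + \<i> * of_real (cmod q)) *\<^sub>C a + \<zeta> *\<^sub>C y"
        using \<zeta> by (simp add: y_def scaleC_diff_right scaleC_scaleC scaleC_add_left)
      then have "norm ((1 + \<i> * of_real (cmod q)) *\<^sub>C a) \<le> norm (a + \<zeta> *\<^sub>C c) + norm (\<zeta> *\<^sub>C y)"
        using norm_triangle_sub[of "(1 + \<i> * of_real (cmod q)) *\<^sub>C a" "a + \<zeta> *\<^sub>C c"] by simp
      also have "\<dots> \<le> 1 + e1"
        using bnd[of \<zeta>] \<zeta> \<open>norm y < e1\<close> by (simp add: norm_scaleC)
      finally have "sqrt (1 + (cmod q)\<^sup>2) * norm a \<le> 1 + e1"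
        by (simp add: norm_scaleC cmod_def)
      moreover have "sqrt (1 + (cmod q)\<^sup>2) * (1 - e1) \<le> sqrt (1 + (cmod q)\<^sup>2) * norm a"
        using a d by (intro mult_left_mono) auto
      ultimately have "sqrt (1 + (cmod q)\<^sup>2) * (1 - e1) \<le> 1 + e1" by simp
      then have "(sqrt (1 + (cmod q)\<^sup>2) * (1 - e1))\<^sup>2 \<le> (1 + e1)\<^sup>2"
        using e1 by (intro power_mono) auto
      then have "(1 + (cmod q)\<^sup>2) * (1 - e1)\<^sup>2 \<le> (1 + e1)\<^sup>2" by (simp add: power_mult_distrib)
      then have "(cmod q)\<^sup>2 * (1 - e1)\<^sup>2 \<le> 4 * e1" by (simp add: power2_eq_square algebra_simps)
      moreover have "(cmod q)\<^sup>2 * (1/2)\<^sup>2 \<le> (cmod q)\<^sup>2 * (1 - e1)\<^sup>2"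
        using e1 by (intro mult_left_mono power_mono) auto
      ultimately show ?thesis using e1 by (simp add: power_divide)
    qed simp
    then have "cmod q \<le> e / 2" by (rule power2_le_imp_le) (use e in simp)
    have "norm c \<le> norm y + norm (q *\<^sub>C a)" using norm_triangle_ineq[of y "q *\<^sub>C a"] by (simp add: y_def)
    also have "norm (q *\<^sub>C a) \<le> cmod q" using a1 by (simp add: norm_scaleC mult_left_le)
    finally show "norm c \<le> e" using \<open>norm y < e1\<close> e1 \<open>cmod q \<le> e / 2\<close> by simp
  qed
  then show ?thesis using d by (intro that[of d]) auto
qed

context absolute_norm
begin

text \<open>Write x = (a, b) and w = (c, h). If a is not small, a support functional of \<nu> turns
  the ball condition into a bound for the norm of a + \<zeta> c that is real-affine in \<zeta>. If a
  is small, |b| is nearly 1, one of b + h, b - h has modulus at least |b|, and a large c would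
  contradict \<open>strict\<close>.\<close>

lemma fst_small_unit:
  assumes cuc: "complex_uniformly_convex TYPE('z::complex_banach)" and strict: "\<And>s. s > 0 \<Longrightarrow> \<nu> s 1 > 1"
    and e: "e > 0"
  obtains \<delta> where "\<delta> > 0" "\<And>x w :: 'z \<times> complex.
    (\<And>\<zeta>. cmod \<zeta> \<le> 1 \<Longrightarrow> sum_norm (x + \<zeta> *\<^sub>C w) \<le> 1) \<Longrightarrow> sum_norm x \<ge> 1 - \<delta> \<Longrightarrow> norm (fst w) \<le> e"
proof -
  \<comment> \<open>k is the gain of \<open>strict\<close> at e/2 and settles the case of small a;
    k' is the gain at the threshold \<eta> and becomes a lower bound for the coefficient l1 in the
    other case.\<close>
  define k where "k = \<nu> (e / 2) 1 - 1"
  have k: "k > 0" using strict[of "e / 2"] e by (simp add: k_def)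
  define \<eta> where "\<eta> = min (e / 2) (k / 4)"
  have \<eta>: "\<eta> > 0" "\<eta> \<le> e / 2" "\<eta> \<le> k / 4" using e k by (auto simp: \<eta>_def)
  define k' where "k' = \<nu> \<eta> 1 - 1"
  have k': "k' > 0" using strict[of \<eta>] \<eta> by (simp add: k'_def)
  obtain d where d: "d > 0" and affine: "\<And>a c :: 'z. \<And>q. cmod q \<le> 1 / (k' * \<eta>) \<Longrightarrow>
      (\<And>\<zeta>. cmod \<zeta> \<le> 1 \<Longrightarrow> norm (a + \<zeta> *\<^sub>C c) \<le> 1 + Re (\<zeta> * q)) \<Longrightarrow> norm a \<ge> 1 - d \<Longrightarrow> norm c \<le> e / 2"
    using complex_uniformly_convex_affine_bound[OF cuc, of "1 / (k' * \<eta>)" "e / 2"] k' \<eta> e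
    by (metis divide_pos_pos half_gt_zero mult_pos_pos zero_less_one)
  \<comment> \<open>The three bounds serve, in order, the case of small a, the estimate t <= 2, and
    the lower bound 1 - d for the norm of a/t.\<close>
  define \<delta> where "\<delta> = min (k / 8) (min k' (d * (k' * \<eta>)))"
  have \<delta>: "\<delta> > 0" "\<delta> < k / 4" "\<delta> \<le> k'" "\<delta> \<le> d * (k' * \<eta>)" using k k' d \<eta> by (auto simp: \<delta>_def)
  have "norm (fst w) \<le> e"
    if bnd: "\<And>\<zeta>. cmod \<zeta> \<le> 1 \<Longrightarrow> sum_norm (x + \<zeta> *\<^sub>C w) \<le> 1" and near: "sum_norm x \<ge> 1 - \<delta>"
    for x w :: "'z \<times> complex"
  proof -
    define a b c h where "a = fst x" and "b = snd x" and "c = fst w" and "h = snd w"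
    have bnd': "\<nu> (norm (a + \<zeta> *\<^sub>C c)) (cmod (b + \<zeta> * h)) \<le> 1" if "cmod \<zeta> \<le> 1" for \<zeta>
      using bnd[OF that]
      by (simp add: sum_norm_def scaleC_prod_def scaleC_complex_def a_def b_def c_def h_def)
    have near': "\<nu> (norm a) (cmod b) \<ge> 1 - \<delta>" using near by (simp add: sum_norm_def a_def b_def)
    have le1: "norm (a + \<zeta> *\<^sub>C c) \<le> 1" "cmod (b + \<zeta> * h) \<le> 1" if "cmod \<zeta> \<le> 1" for \<zeta>
      using bnd'[OF that] ge_left[of "norm (a + \<zeta> *\<^sub>C c)" "cmod (b + \<zeta> * h)"]
        ge_right[of "norm (a + \<zeta> *\<^sub>C c)" "cmod (b + \<zeta> * h)"] by simp_all
    have a1: "norm a \<le> 1" and b1: "cmod b \<le> 1" using le1[of 0] by simp_all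
    have h1: "cmod h \<le> 1"
      using le1(2)[of 1] le1(2)[of "-1"] norm_triangle_ineq4[of "b + h" "b - h"]
      by (simp add: norm_mult flip: mult_2)
    show ?thesis
    proof (cases "norm a \<le> \<eta>")
      case True
      have b: "cmod b \<ge> 1 - \<delta> - \<eta>" using near' le_add[of "norm a" "cmod b"] True by simp
      show ?thesis
      proof (rule ccontr)
        assume "\<not> norm (fst w) \<le> e"
        then have c: "norm c > e" by (simp add: c_def)
        have "2 * cmod b \<le> cmod (b + h) + cmod (b - h)"
          using norm_triangle_ineq[of "b + h" "b - h"] by (simp add: norm_mult flip: mult_2)
        then have "cmod (b + 1 * h) \<ge> cmod b \<or> cmod (b + (- 1) * h) \<ge> cmod b" by auto
        then obtain \<zeta> where \<zeta>: "cmod \<zeta> = 1" "cmod (b + \<zeta> * h) \<ge> cmod b"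
          by (metis norm_minus_cancel norm_one)
        have "norm (a + \<zeta> *\<^sub>C c) \<ge> e / 2"
          using norm_triangle_ineq4[of "a + \<zeta> *\<^sub>C c" a] \<zeta> c True \<eta> by (simp add: norm_scaleC)
        then have "\<nu> (e / 2) (cmod b) \<le> 1"
          using bnd'[of \<zeta>] \<zeta> mono[of "e / 2" "norm (a + \<zeta> *\<^sub>C c)" "cmod b" "cmod (b + \<zeta> * h)"] e by simp
        then have "\<nu> (e / 2) 1 \<le> 1 + (1 - cmod b)" using diff_right[of "e / 2" "cmod b" 1] e b1 by simp
        then show False using b \<eta> \<delta> k by (simp add: k_def)
      qed
    next
      case False
      obtain l1 l2 where l: "l1 * norm a + l2 * cmod b = \<nu> (norm a) (cmod b)"
        and l_le: "\<And>s t. l1 * s + l2 * t \<le> \<nu> \<bar>s\<bar> \<bar>t\<bar>"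
        using support[of "norm a" "cmod b"] by (metis abs_norm_cancel)
      have l2: "\<bar>l2\<bar> \<le> 1" using l_le[of 0 1] l_le[of 0 "-1"] right_0[of 1] by simp
      \<comment> \<open>Strictness at \<eta> forces the support functional to charge the first
        coordinate: as l2 |b| <= |b|, it follows that l1 times the norm of a is at least k'.\<close>
      have "\<nu> \<eta> 1 \<le> \<nu> \<eta> (cmod b) + (1 - cmod b)" using \<eta> b1 by (intro diff_right) auto
      also have "\<nu> \<eta> (cmod b) \<le> \<nu> (norm a) (cmod b)" using \<eta> False by (intro mono_left) auto
      finally have "k' \<le> l1 * norm a"
        using l l_le[of 0 "cmod b"] right_0[of "cmod b"] by (simp add: k'_def)
      moreover have "norm a > 0" using False \<eta> by auto
      ultimately have "l1 > 0" using k' by (meson less_le_trans zero_less_mult_pos2)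
      have l1: "k' \<le> l1" "l1 > 0"
        using \<open>k' \<le> l1 * norm a\<close> \<open>l1 > 0\<close> mult_left_le[OF a1, of l1] by linarith+
      obtain s where s: "cmod s = 1" "s * b = of_real (cmod b)" by (rule complex_rotation)
      \<comment> \<open>s turns b to the nonnegative real axis, so the real part of s (b + \<zeta>
        h) is |b| + Re (\<zeta> s h); q0 is this variation with its weight l2 moved to the other
        side and divided by l1.\<close>
      define q0 where "q0 = - (of_real l2 * s * h) / of_real l1"
      have q0: "cmod q0 \<le> 1 / k'"
      proof -
        have "cmod q0 = \<bar>l2\<bar> * cmod h / l1" using s l1 by (simp add: q0_def norm_divide norm_mult)
        also have "\<dots> \<le> 1 / k'" using l1 l2 h1 k' by (intro frac_le) (auto intro: mult_le_one)
        finally show ?thesis .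
      qed
      define t where "t = norm a + \<delta> / k'"
      have "0 \<le> \<delta> / k'" "\<delta> / k' \<le> 1" using k' \<delta> by simp_all
      then have t: "t \<ge> \<eta>" "t \<le> 2" using False a1 by (simp_all add: t_def)
      have t0: "t > 0" using t \<eta> by simp
      have at: "norm (a + \<zeta> *\<^sub>C c) \<le> t + Re (\<zeta> * q0)" if \<zeta>: "cmod \<zeta> \<le> 1" for \<zeta>
      proof -
        \<comment> \<open>The support inequality is used at the real part of s (b + \<zeta> h), not
          at its modulus: the real part is affine in \<zeta>, and monotonicity of \<nu> makes the
          passage to the modulus valid for either sign of l2.\<close>
        have "l1 * norm (a + \<zeta> *\<^sub>C c) + l2 * Re (s * (b + \<zeta> * h))
            \<le> \<nu> (norm (a + \<zeta> *\<^sub>C c)) \<bar>Re (s * (b + \<zeta> * h))\<bar>"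
          using l_le[of "norm (a + \<zeta> *\<^sub>C c)" "Re (s * (b + \<zeta> * h))"] by simp
        also have "\<dots> \<le> \<nu> (norm (a + \<zeta> *\<^sub>C c)) (cmod (b + \<zeta> * h))"
          using abs_Re_le_cmod[of "s * (b + \<zeta> * h)"] s by (intro mono_right) (auto simp: norm_mult)
        also have "\<dots> \<le> 1" by (rule bnd'[OF \<zeta>])
        also have "Re (s * (b + \<zeta> * h)) = cmod b + Re (\<zeta> * (s * h))"
        proof -
          have "s * (b + \<zeta> * h) = of_real (cmod b) + \<zeta> * (s * h)"
            using s(2) by (simp add: algebra_simps)
          then show ?thesis by (simp only: plus_complex.sel Re_complex_of_real)
        qed
        finally have "l1 * norm (a + \<zeta> *\<^sub>C c) \<le> l1 * norm a + \<delta> - l2 * Re (\<zeta> * (s * h))"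
          using l near' by (simp add: distrib_left)
        also have "\<dots> = l1 * (norm a + \<delta> / l1 + Re (\<zeta> * q0))"
        proof -
          have "\<zeta> * q0 = of_real (- (l2 / l1)) * (\<zeta> * (s * h))" by (simp add: q0_def)
          then have eq: "Re (\<zeta> * q0) = - (l2 / l1) * Re (\<zeta> * (s * h))" by (simp only: Re_of_real_mult)
          show ?thesis unfolding eq using l1 by (simp add: algebra_simps del: times_complex.sel)
        qed
        finally have "norm (a + \<zeta> *\<^sub>C c) \<le> norm a + \<delta> / l1 + Re (\<zeta> * q0)" using l1 by simp
        also have "\<delta> / l1 \<le> \<delta> / k'" using l1 k' \<delta> by (simp add: frac_le)
        finally show ?thesis by (simp add: t_def)
      qed
      have "norm ((1 / t) *\<^sub>R c) \<le> e / 2"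
      proof (rule affine)
        show "cmod (of_real (1 / t) * q0) \<le> 1 / (k' * \<eta>)"
        proof -
          have "cmod (of_real (1 / t) * q0) = (1 / t) * cmod q0" using t0 by (simp add: norm_mult norm_divide)
          also have "\<dots> \<le> (1 / \<eta>) * (1 / k')"
            using q0 t \<eta> t0 by (intro mult_mono) (auto simp: frac_le)
          finally show ?thesis by (simp add: mult.commute)
        qed
        show "norm ((1 / t) *\<^sub>R a + \<zeta> *\<^sub>C (1 / t) *\<^sub>R c) \<le> 1 + Re (\<zeta> * (of_real (1 / t) * q0))" if "cmod \<zeta> \<le> 1" for \<zeta>
        proof -
          have "(1 / t) *\<^sub>R a + \<zeta> *\<^sub>C (1 / t) *\<^sub>R c = (1 / t) *\<^sub>R (a + \<zeta> *\<^sub>C c)"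
            unfolding scaleC_of_real[symmetric] scaleC_add_right scaleC_scaleC by (simp add: mult.commute)
          then have "norm ((1 / t) *\<^sub>R a + \<zeta> *\<^sub>C (1 / t) *\<^sub>R c) = (1 / t) * norm (a + \<zeta> *\<^sub>C c)" using t0 by simp
          also have "\<dots> \<le> (1 / t) * (t + Re (\<zeta> * q0))" using at[OF that] t0 by (intro mult_left_mono) auto
          also have "\<dots> = 1 + (1 / t) * Re (\<zeta> * q0)" using t0 by (simp add: distrib_left)
          also have "(1 / t) * Re (\<zeta> * q0) = Re (of_real (1 / t) * (\<zeta> * q0))" by (simp only: Re_of_real_mult)
          finally show ?thesis by (simp only: mult.left_commute)
        qed
        have "\<delta> / k' \<le> d * t"
        proof -
          have "\<delta> / k' \<le> d * \<eta>" using \<delta>(4) k' by (simp add: field_simps)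
          also have "\<dots> \<le> d * t" using t d by simp
          finally show ?thesis .
        qed
        then show "norm ((1 / t) *\<^sub>R a) \<ge> 1 - d" using t0 by (simp add: t_def field_simps)
      qed
      then have "norm c \<le> e / 2 * t" using t0 by (simp add: field_simps)
      also have "\<dots> \<le> e / 2 * 2" using t e by (intro mult_left_mono) auto
      finally show ?thesis by (simp add: c_def)
    qed
  qed
  then show ?thesis using \<delta> by (intro that[of \<delta>]) auto
qed

lemma fst_small:
  assumes cuc: "complex_uniformly_convex TYPE('z::complex_banach)" and strict: "\<And>s. s > 0 \<Longrightarrow> \<nu> s 1 > 1"
    and e: "e > 0" and M: "M > 0"
  obtains \<delta> where "\<delta> > 0" "\<And>x w :: 'z \<times> complex.
    (\<And>\<zeta>. cmod \<zeta> \<le> 1 \<Longrightarrow> sum_norm (x + \<zeta> *\<^sub>C w) \<le> M) \<Longrightarrow> sum_norm x \<ge> M - \<delta> \<Longrightarrow> norm (fst w) \<le> e"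
proof -
  note N = cnorm_sum_norm[where 'z = 'z]
  obtain \<delta> where \<delta>: "\<delta> > 0" and small: "\<And>x w :: 'z \<times> complex.
    (\<And>\<zeta>. cmod \<zeta> \<le> 1 \<Longrightarrow> sum_norm (x + \<zeta> *\<^sub>C w) \<le> 1) \<Longrightarrow> sum_norm x \<ge> 1 - \<delta> \<Longrightarrow> norm (fst w) \<le> e / M"
    using fst_small_unit[OF cuc strict, of "e / M"] e M by (metis divide_pos_pos)
  have "norm (fst w) \<le> e" if bnd: "\<And>\<zeta>. cmod \<zeta> \<le> 1 \<Longrightarrow> sum_norm (x + \<zeta> *\<^sub>C w) \<le> M"
    and near: "sum_norm x \<ge> M - M * \<delta>" for x w :: "'z \<times> complex"
  proof -
    have "norm (fst ((1 / M) *\<^sub>R w)) \<le> e / M"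
    proof (rule small)
      show "sum_norm ((1 / M) *\<^sub>R x + \<zeta> *\<^sub>C (1 / M) *\<^sub>R w) \<le> 1" if "cmod \<zeta> \<le> 1" for \<zeta>
      proof -
        have "(1 / M) *\<^sub>R x + \<zeta> *\<^sub>C (1 / M) *\<^sub>R w = (1 / M) *\<^sub>R (x + \<zeta> *\<^sub>C w)"
          unfolding scaleC_of_real[symmetric] scaleC_add_right scaleC_scaleC by (simp add: mult.commute)
        then show ?thesis using bnd[OF that] M by (simp add: cnorm_scaleR[OF N])
      qed
      have "(1 / M) * (M - M * \<delta>) \<le> (1 / M) * sum_norm x" using near M by (intro mult_left_mono) auto
      then show "sum_norm ((1 / M) *\<^sub>R x) \<ge> 1 - \<delta>"
        using M by (simp add: cnorm_scaleR[OF N] diff_divide_distrib)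
    qed
    then show ?thesis using M by (simp add: field_simps)
  qed
  then show ?thesis using \<delta> M by (intro that[of "M * \<delta>"]) auto
qed

text \<open>The first components of \<open>A\<^sup>2 u\<close> and \<open>A\<^sup>3 u\<close> vanish along a maximizing sequence, and the scalar
  components of \<open>A\<^sup>2 u\<close> have a limit point \<open>d\<close>. If \<open>d \<noteq> 0\<close> then \<open>(0, 1)\<close> is an eigenvector of \<open>A\<close>, which
  forces the first component of \<open>A u\<close> to vanish as well; the maximum is then approached in the
  scalar component alone, where \<open>d \<noteq> 0\<close> is impossible.\<close>

lemma maximizing_contradiction:
  fixes A :: "'z::complex_banach \<times> complex \<Rightarrow> 'z \<times> complex"
  assumes cuc: "complex_uniformly_convex TYPE('z)" and strict: "\<And>s. s > 0 \<Longrightarrow> \<nu> s 1 > 1"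
    and lin: "complex_linear A" and M: "M > 0" and bnd: "\<And>u. sum_norm (A u) \<le> M * sum_norm u"
    and c: "c1 > 0" "c2 > 0"
    and F1: "\<And>z u. cmod z \<le> 1 \<Longrightarrow> sum_norm (A u + (z * of_real c1) *\<^sub>C A (A u)) \<le> M * sum_norm u"
    and F2: "\<And>z u. cmod z \<le> 1 \<Longrightarrow> sum_norm (A u + (z * of_real c2) *\<^sub>C A (A (A u))) \<le> M * sum_norm u"
    and landau: "\<And>e. e > 0 \<Longrightarrow> \<exists>K. \<forall>u. sum_norm (A u) \<le> K * sum_norm (A (A u)) + e * sum_norm u"
    and max: "\<And>\<delta>. \<delta> > 0 \<Longrightarrow> \<exists>u. sum_norm u \<le> 1 \<and> sum_norm (A u) > M - \<delta>"
  shows False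
proof -
  let ?P = "sum_norm :: 'z \<times> complex \<Rightarrow> real"
  note N = cnorm_sum_norm[where 'z = 'z]
  note add = complex_linear_add[OF lin] complex_linear_diff[OF lin] and sc = complex_linear_scaleC[OF lin]
  have "\<forall>n::nat. \<exists>u. ?P u \<le> 1 \<and> ?P (A u) > M - 1 / (real n + 1)" by (intro allI max) simp
  then obtain u0 where u0: "\<And>n. ?P (u0 n) \<le> 1" "\<And>n. ?P (A (u0 n)) > M - 1 / (real n + 1)" by metis
  have PA: "?P (A v) \<le> M * K" if "?P v \<le> K" for v K
    using bnd[of v] that M by (meson mult_left_mono order_trans less_imp_le)
  have lim0: "(\<lambda>n. ?P (A (u0 n))) \<longlonglongrightarrow> M"
  proof (rule tendsto_sandwich)
    have "(\<lambda>n. 1 / (real n + 1)) \<longlonglongrightarrow> 0"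
      using LIMSEQ_inverse_real_of_nat by (simp add: inverse_eq_divide add.commute)
    from tendsto_diff[OF tendsto_const[of M] this]
    show "(\<lambda>n. M - 1 / (real n + 1)) \<longlonglongrightarrow> M" by simp
    show "\<forall>\<^sub>F n in sequentially. M - 1 / (real n + 1) \<le> ?P (A (u0 n))" using u0 by (simp add: less_imp_le)
    show "\<forall>\<^sub>F n in sequentially. ?P (A (u0 n)) \<le> M" using PA[OF u0(1)] by simp
  qed simp
  have fst_lim: "(\<lambda>n. norm (fst (W n))) \<longlonglongrightarrow> 0"
    if c: "c > 0" and W: "\<And>z n. cmod z \<le> 1 \<Longrightarrow> ?P (A (u0 n) + (z * of_real c) *\<^sub>C W n) \<le> M" for c W
  proof (rule LIMSEQ_I)
    fix r :: real assume r: "r > 0"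
    obtain \<delta> where \<delta>: "\<delta> > 0" and small: "\<And>x w :: 'z \<times> complex.
      (\<And>\<zeta>. cmod \<zeta> \<le> 1 \<Longrightarrow> ?P (x + \<zeta> *\<^sub>C w) \<le> M) \<Longrightarrow> ?P x \<ge> M - \<delta> \<Longrightarrow> norm (fst w) \<le> c * r / 2"
      using fst_small[OF cuc strict, of "c * r / 2" M] c r M by (metis half_gt_zero mult_pos_pos)
    have "\<forall>\<^sub>F n in sequentially. ?P (A (u0 n)) > M - \<delta>" using lim0 \<delta> by (intro order_tendstoD) auto
    then obtain n0 where n0: "\<And>n. n \<ge> n0 \<Longrightarrow> ?P (A (u0 n)) > M - \<delta>" by (auto simp: eventually_sequentially)
    have "norm (fst (W n)) < r" if "n \<ge> n0" for n
    proof -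
      have "norm (fst (of_real c *\<^sub>C W n)) \<le> c * r / 2"
        using n0[OF that] W by (intro small[of "A (u0 n)"]) (simp_all add: scaleC_scaleC less_imp_le)
      then have "c * norm (fst (W n)) \<le> c * (r / 2)" using c by (simp add: scaleC_prod_def norm_scaleC)
      then have "norm (fst (W n)) \<le> r / 2" using c by simp
      then show ?thesis using r by simp
    qed
    then show "\<exists>no. \<forall>n\<ge>no. norm (norm (fst (W n)) - 0) < r" by auto
  qed
  have bnd1: "M * ?P (u0 n) \<le> M" for n using u0(1)[of n] M by (simp add: mult_left_le)
  have fst2: "(\<lambda>n. norm (fst (A (A (u0 n))))) \<longlonglongrightarrow> 0"
    by (rule fst_lim[OF c(1)]) (use F1 bnd1 order_trans in blast)
  have fst3: "(\<lambda>n. norm (fst (A (A (A (u0 n)))))) \<longlonglongrightarrow> 0"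
    by (rule fst_lim[OF c(2)]) (use F2 bnd1 order_trans in blast)
  have "bounded (range (\<lambda>n. snd (A (A (u0 n)))))"
  proof -
    have "cmod (snd (A (A (u0 n)))) \<le> M * (M * 1)" for n
      using sum_norm_ge(2)[of "A (A (u0 n))"] PA[OF PA[OF u0(1)[of n]]] by simp
    then show ?thesis by (auto simp: bounded_iff)
  qed
  then obtain d r where r: "strict_mono (r :: nat \<Rightarrow> nat)" and d: "((\<lambda>n. snd (A (A (u0 n)))) \<circ> r) \<longlonglongrightarrow> d"
    using bounded_imp_convergent_subsequence by metis
  define u where "u n = u0 (r n)" for n
  have sub: "(\<lambda>n. f (r n)) \<longlonglongrightarrow> l" if "f \<longlonglongrightarrow> l" for f and l :: real
    using LIMSEQ_subseq_LIMSEQ[OF that r] by (simp add: o_def)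
  have u1: "?P (u n) \<le> 1" for n using u0 by (simp add: u_def)
  have limM: "(\<lambda>n. ?P (A (u n))) \<longlonglongrightarrow> M" unfolding u_def by (rule sub[OF lim0])
  have f2: "(\<lambda>n. norm (fst (A (A (u n))))) \<longlonglongrightarrow> 0" unfolding u_def by (rule sub[OF fst2])
  have f3: "(\<lambda>n. norm (fst (A (A (A (u n)))))) \<longlonglongrightarrow> 0" unfolding u_def by (rule sub[OF fst3])
  have dl: "(\<lambda>n. snd (A (A (u n)))) \<longlonglongrightarrow> d" using d by (simp add: u_def o_def)
  have null: "(\<lambda>n. ?P (f n)) \<longlonglongrightarrow> 0" if "\<And>n. ?P (f n) \<le> g n" "g \<longlonglongrightarrow> 0" for f g
    by (rule tendsto_sandwich[OF _ _ tendsto_const that(2)]) (auto simp: that(1) cnorm_nonneg[OF N])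
  \<comment> \<open>The interpolation inequality acts as a quantitative injectivity of A: along
    bounded sequences, vanishing of A (A v) forces vanishing of A v.\<close>
  have landau': "(\<lambda>n. ?P (A (v n))) \<longlonglongrightarrow> 0"
    if v: "\<And>n. ?P (v n) \<le> V" and AA: "(\<lambda>n. ?P (A (A (v n)))) \<longlonglongrightarrow> 0" for v :: "nat \<Rightarrow> _" and V
  proof (rule LIMSEQ_I)
    fix s :: real assume s: "s > 0"
    have V: "V \<ge> 0" using v[of 0] cnorm_nonneg[OF N, of "v 0"] by simp
    define e where "e = s / (2 * (V + 1))"
    have e: "e > 0" "e * V < s / 2" using s V by (auto simp: e_def field_simps)
    obtain K where K: "\<And>u. ?P (A u) \<le> K * ?P (A (A u)) + e * ?P u" using landau[OF e(1)] by blast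
    have "(\<lambda>n. K * ?P (A (A (v n)))) \<longlonglongrightarrow> 0" by (rule tendsto_mult_right_zero[OF AA])
    then have "\<forall>\<^sub>F n in sequentially. K * ?P (A (A (v n))) < s / 2" using s by (intro order_tendstoD) auto
    then obtain n0 where n0: "\<And>n. n \<ge> n0 \<Longrightarrow> K * ?P (A (A (v n))) < s / 2" by (auto simp: eventually_sequentially)
    have "?P (A (v n)) < s" if "n \<ge> n0" for n
    proof -
      have "e * ?P (v n) \<le> e * V" using v e by (intro mult_left_mono) auto
      then show ?thesis using K[of "v n"] n0[OF that] e by linarith
    qed
    then show "\<exists>no. \<forall>n\<ge>no. norm (?P (A (v n)) - 0) < s" by (auto simp: cnorm_nonneg[OF N])
  qed
  define e :: "'z \<times> complex" where "e = (0, 1)"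
  have diff2: "(\<lambda>n. ?P (A (A (u n)) - d *\<^sub>C e)) \<longlonglongrightarrow> 0"
  proof (rule null)
    show "?P (A (A (u n)) - d *\<^sub>C e) \<le> norm (fst (A (A (u n)))) + cmod (snd (A (A (u n))) - d)" for n
      using sum_norm_le[of "A (A (u n)) - d *\<^sub>C e"] by (simp add: e_def scaleC_prod_def scaleC_complex_def)
    have "(\<lambda>n. cmod (snd (A (A (u n))) - d)) \<longlonglongrightarrow> 0"
      using dl by (simp add: tendsto_norm_zero_iff LIM_zero_iff)
    then show "(\<lambda>n. norm (fst (A (A (u n)))) + cmod (snd (A (A (u n))) - d)) \<longlonglongrightarrow> 0"
      by (rule tendsto_add_zero[OF f2])
  qed
  have diff3: "(\<lambda>n. ?P (A (A (A (u n))) - d *\<^sub>C A e)) \<longlonglongrightarrow> 0"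
  proof (rule null)
    show "?P (A (A (A (u n))) - d *\<^sub>C A e) \<le> M * ?P (A (A (u n)) - d *\<^sub>C e)" for n
      using bnd[of "A (A (u n)) - d *\<^sub>C e"] by (simp add: add sc)
  qed (rule tendsto_mult_right_zero[OF diff2])
  have not2: "\<not> (\<lambda>n. ?P (A (A (u n)))) \<longlonglongrightarrow> 0"
  proof
    assume "(\<lambda>n. ?P (A (A (u n)))) \<longlonglongrightarrow> 0"
    then have "(\<lambda>n. ?P (A (u n))) \<longlonglongrightarrow> 0" by (rule landau'[OF u1])
    then show False using LIMSEQ_unique[OF limM] M by auto
  qed
  have d0: "d \<noteq> 0" using not2 diff2 by auto
  \<comment> \<open>A (A (A u)) tends to d A e while its Y-component tends to 0.\<close>
  have "norm (fst (d *\<^sub>C A e)) \<le> 0"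
  proof (rule tendsto_lowerbound)
    show "(\<lambda>n. norm (fst (A (A (A (u n))))) + ?P (A (A (A (u n))) - d *\<^sub>C A e)) \<longlonglongrightarrow> 0"
      by (rule tendsto_add_zero[OF f3 diff3])
    have "norm (fst (d *\<^sub>C A e)) \<le> norm (fst (A (A (A (u n))))) + ?P (A (A (A (u n))) - d *\<^sub>C A e)" for n
      using sum_norm_ge(1)[of "A (A (A (u n))) - d *\<^sub>C A e"]
        norm_triangle_ineq4[of "fst (A (A (A (u n))))" "fst (A (A (A (u n))) - d *\<^sub>C A e)"] by simp
    then show "\<forall>\<^sub>F n in sequentially. norm (fst (d *\<^sub>C A e))
        \<le> norm (fst (A (A (A (u n))))) + ?P (A (A (A (u n))) - d *\<^sub>C A e)" by simp
  qed simp
  then have "fst (A e) = 0"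
    using d0 by (simp add: scaleC_prod_def norm_scaleC mult_le_0_iff flip: norm_le_zero_iff)
  define k where "k = snd (A e)"
  have Ae: "A e = k *\<^sub>C e"
    using \<open>fst (A e) = 0\<close> by (simp add: e_def k_def prod_eq_iff scaleC_prod_def scaleC_complex_def)
  have k0: "k \<noteq> 0"
  proof
    assume "k = 0"
    then have "(\<lambda>n. ?P (A (A (A (u n))))) \<longlonglongrightarrow> 0" using diff3 by (simp add: Ae)
    then have "(\<lambda>n. ?P (A (A (u n)))) \<longlonglongrightarrow> 0" by (rule landau'[OF PA[OF u1]])
    then show False using not2 by simp
  qed
  \<comment> \<open>Subtracting (d / k^2) e removes the limit of A (A u), since A (A e) = k^2 e. As
    A keeps e on its line, the correction leaves the first component of A u unchanged.\<close>
  define v where "v n = u n - (d / k\<^sup>2) *\<^sub>C e" for n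
  have lim_v: "(\<lambda>n. ?P (A (v n))) \<longlonglongrightarrow> 0"
  proof (rule landau')
    show "?P (v n) \<le> 1 + ?P ((d / k\<^sup>2) *\<^sub>C e)" for n
      using cnorm_triangle_diff[OF N, of "u n" "(d / k\<^sup>2) *\<^sub>C e"] u1[of n] by (simp add: v_def)
    have "A (A (v n)) = A (A (u n)) - d *\<^sub>C e" for n
      using k0 by (simp add: v_def add sc Ae scaleC_scaleC power2_eq_square)
    then show "(\<lambda>n. ?P (A (A (v n)))) \<longlonglongrightarrow> 0" using diff2 by simp
  qed
  have "norm (fst (A (u n))) \<le> ?P (A (v n))" for n
  proof -
    have "A (v n) = A (u n) - (d / k\<^sup>2 * k) *\<^sub>C e" by (simp add: v_def add sc Ae scaleC_scaleC)
    then have "fst (A (v n)) = fst (A (u n))" by (simp add: e_def scaleC_prod_def)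
    then show ?thesis using sum_norm_ge(1)[of "A (v n)"] by simp
  qed
  then have f1: "(\<lambda>n. norm (fst (A (u n)))) \<longlonglongrightarrow> 0"
    by (intro Lim_null_comparison[OF _ lim_v]) simp
  have s1: "(\<lambda>n. cmod (snd (A (u n)))) \<longlonglongrightarrow> M"
  proof (rule tendsto_sandwich)
    show "(\<lambda>n. ?P (A (u n)) - norm (fst (A (u n)))) \<longlonglongrightarrow> M" using tendsto_diff[OF limM f1] by simp
    show "\<forall>\<^sub>F n in sequentially. ?P (A (u n)) - norm (fst (A (u n))) \<le> cmod (snd (A (u n)))"
      using sum_norm_le[of "A (u _)"] by (simp add: algebra_simps)
    show "\<forall>\<^sub>F n in sequentially. cmod (snd (A (u n))) \<le> ?P (A (u n))" by (simp add: sum_norm_ge)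
  qed (rule limM)
  \<comment> \<open>Parallelogram law in the complex plane: if b + w and b - w have modulus at most
    M, then |w|^2 <= M^2 - |b|^2. Here |b| tends to M and |w| to c1 |d|.\<close>
  have "(c1 * cmod d)\<^sup>2 \<le> 0"
  proof (rule tendsto_le[OF _ _ tendsto_power[OF tendsto_mult[OF tendsto_const tendsto_norm[OF dl]]]])
    show "(\<lambda>n. M\<^sup>2 - (cmod (snd (A (u n))))\<^sup>2) \<longlonglongrightarrow> 0"
      using tendsto_diff[OF tendsto_const[of "M\<^sup>2"] tendsto_power[OF s1, of 2]] by simp
    have "(c1 * cmod (snd (A (A (u n)))))\<^sup>2 \<le> M\<^sup>2 - (cmod (snd (A (u n))))\<^sup>2" for n
    proof -
      define b w where "b = snd (A (u n))" and "w = of_real c1 * snd (A (A (u n)))"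
      have "cmod (b + z * w) \<le> M" if "cmod z \<le> 1" for z
      proof -
        have "cmod (b + z * w) = cmod (snd (A (u n) + (z * of_real c1) *\<^sub>C A (A (u n))))"
          by (simp add: b_def w_def scaleC_prod_def scaleC_complex_def mult.assoc)
        also have "\<dots> \<le> M * ?P (u n)" using F1[OF that] sum_norm_ge(2) by (rule order_trans[rotated])
        also have "\<dots> \<le> M" using u1[of n] M by (simp add: mult_left_le)
        finally show ?thesis .
      qed
      from this[of 1] this[of "-1"] have "cmod (b + w) \<le> M" "cmod (b - w) \<le> M" by simp_all
      then have "(cmod (b + w))\<^sup>2 + (cmod (b - w))\<^sup>2 \<le> M\<^sup>2 + M\<^sup>2"
        by (intro add_mono power_mono) auto
      moreover have "(cmod (b + w))\<^sup>2 + (cmod (b - w))\<^sup>2 = 2 * (cmod b)\<^sup>2 + 2 * (cmod w)\<^sup>2"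
        unfolding cmod_power2 by (simp add: power2_eq_square algebra_simps)
      ultimately have "(cmod w)\<^sup>2 \<le> M\<^sup>2 - (cmod b)\<^sup>2" by simp
      then show ?thesis using c by (simp add: b_def w_def norm_mult)
    qed
    then show "\<forall>\<^sub>F n in sequentially. (c1 * cmod (snd (A (A (u n)))))\<^sup>2 \<le> M\<^sup>2 - (cmod (snd (A (u n))))\<^sup>2" by simp
  qed simp
  then show False using c d0 by simp
qed

end

section \<open>Duality\<close>

context absolute_norm
begin

text \<open>For an absolute norm and nonnegative \<alpha>, \<beta> the supremum over the nonnegative
  part of the unit ball equals that over the whole ball, so this is the dual norm on the first
  quadrant.\<close>

definition dual :: "real \<Rightarrow> real \<Rightarrow> real"
  where "dual \<alpha> \<beta> = (SUP p\<in>{(a, b). 0 \<le> a \<and> 0 \<le> b \<and> \<nu> a b \<le> 1}. \<alpha> * fst p + \<beta> * snd p)"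

lemma unit_le_1: "\<lbrakk>0 \<le> a; 0 \<le> b; \<nu> a b \<le> 1\<rbrakk> \<Longrightarrow> a \<le> 1 \<and> b \<le> 1"
  using ge_left[of a b] ge_right[of a b] by simp

lemma dual_upper:
  assumes "0 \<le> \<alpha>" "0 \<le> \<beta>" "0 \<le> a" "0 \<le> b" "\<nu> a b \<le> 1"
  shows "\<alpha> * a + \<beta> * b \<le> dual \<alpha> \<beta>"
proof -
  have "\<alpha> * fst p + \<beta> * snd p \<le> \<alpha> + \<beta>" if "p \<in> {(a, b). 0 \<le> a \<and> 0 \<le> b \<and> \<nu> a b \<le> 1}" for p
    using unit_le_1[of "fst p" "snd p"] that assms by (auto intro!: add_mono mult_left_le)
  then have "bdd_above ((\<lambda>p. \<alpha> * fst p + \<beta> * snd p) ` {(a, b). 0 \<le> a \<and> 0 \<le> b \<and> \<nu> a b \<le> 1})"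
    by (rule bdd_aboveI2)
  from cSUP_upper[OF _ this, of "(a, b)"] show ?thesis using assms by (simp add: dual_def)
qed

lemma dual_least:
  assumes "\<And>a b. 0 \<le> a \<Longrightarrow> 0 \<le> b \<Longrightarrow> \<nu> a b \<le> 1 \<Longrightarrow> \<alpha> * a + \<beta> * b \<le> K"
  shows "dual \<alpha> \<beta> \<le> K"
proof -
  have "(0, 0) \<in> {(a, b). 0 \<le> a \<and> 0 \<le> b \<and> \<nu> a b \<le> 1}" using left_0[of 0] by simp
  then show ?thesis unfolding dual_def by (intro cSUP_least) (use assms in auto)
qed

lemma holder:
  assumes "0 \<le> \<alpha>" "0 \<le> \<beta>" "0 \<le> a" "0 \<le> b"
  shows "\<alpha> * a + \<beta> * b \<le> dual \<alpha> \<beta> * \<nu> a b"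
proof (cases "\<nu> a b = 0")
  case True
  then show ?thesis using ge_left[of a b] ge_right[of a b] assms by simp
next
  case False
  define r where "r = \<nu> a b"
  have r: "r > 0" using False ge_left[of a b] assms by (simp add: r_def)
  have "\<nu> (inverse r * a) (inverse r * b) \<le> 1"
    using homogeneous[of "inverse r" a b] r assms by (simp add: r_def)
  then have "\<alpha> * (inverse r * a) + \<beta> * (inverse r * b) \<le> dual \<alpha> \<beta>"
    using r assms by (intro dual_upper) auto
  then show ?thesis using r by (simp add: r_def[symmetric] field_simps)
qed

text \<open>The nonnegative part of the unit ball lies in the unit square and contains (1, 0) and
  (0, 1); this gives the axis values and the two lower bounds.\<close>

lemma absolute_norm_dual: "absolute_norm dual"
proof
  fix a b a' b' r :: real
  show "a \<le> dual a b" if "0 \<le> a" "0 \<le> b"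
    using dual_upper[of a b 1 0] left_0[of 1] that by simp
  show "b \<le> dual a b" if "0 \<le> a" "0 \<le> b"
    using dual_upper[of a b 0 1] right_0[of 1] that by simp
  show "dual (a + a') (b + b') \<le> dual a b + dual a' b'" if "0 \<le> a" "0 \<le> b" "0 \<le> a'" "0 \<le> b'"
  proof (rule dual_least)
    fix x y :: real assume "0 \<le> x" "0 \<le> y" "\<nu> x y \<le> 1"
    then show "(a + a') * x + (b + b') * y \<le> dual a b + dual a' b'"
      using dual_upper[of a b x y] dual_upper[of a' b' x y] that by (simp add: algebra_simps)
  qed
  have half: "dual (c * a) (c * b) \<le> c * dual a b" if "0 \<le> c" "0 \<le> a" "0 \<le> b" for c a b
  proof (rule dual_least)
    fix x y :: real assume "0 \<le> x" "0 \<le> y" "\<nu> x y \<le> 1"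
    then have "c * (a * x + b * y) \<le> c * dual a b" using that by (intro mult_left_mono dual_upper) auto
    then show "c * a * x + c * b * y \<le> c * dual a b" by (simp add: algebra_simps)
  qed
  show "dual (r * a) (r * b) = r * dual a b" if "0 \<le> r" "0 \<le> a" "0 \<le> b"
  proof (cases "r = 0")
    case True
    have "dual 0 0 \<le> 0" by (rule dual_least) simp
    then show ?thesis using True dual_upper[of 0 0 0 0] left_0[of 0] by simp
  next
    case False
    then have "dual (inverse r * (r * a)) (inverse r * (r * b)) \<le> inverse r * dual (r * a) (r * b)"
      using that by (intro half) auto
    then have "r * dual a b \<le> dual (r * a) (r * b)" using False that by (simp add: field_simps)
    then show ?thesis using half[of r a b] that by simp
  qed
  show "dual a 0 = a" if "0 \<le> a"
  proof (rule antisym)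
    show "dual a 0 \<le> a" by (rule dual_least) (use unit_le_1 that in \<open>simp add: mult_left_le\<close>)
    show "a \<le> dual a 0" using dual_upper[of a 0 1 0] left_0[of 1] that by simp
  qed
  show "dual 0 b = b" if "0 \<le> b"
  proof (rule antisym)
    show "dual 0 b \<le> b" by (rule dual_least) (use unit_le_1 that in \<open>simp add: mult_left_le\<close>)
    show "b \<le> dual 0 b" using dual_upper[of 0 b 0 1] right_0[of 1] that by simp
  qed
qed

text \<open>The point (z, 1) belongs to the unit ball of \<nu>, and testing the dual norm on it
  gives at least s z + 1.\<close>

lemma dual_strict:
  assumes "z > 0" "\<nu> z 1 \<le> 1" "s > 0"
  shows "dual s 1 > 1"
proof -
  have "s * z > 0" using assms by simp
  moreover have "s * z + 1 \<le> dual s 1" using dual_upper[of s 1 z 1] assms by simp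
  ultimately show ?thesis by simp
qed

end

text \<open>Bilinear rather than sesquilinear, so that adjoints with respect to it are complex
  linear.\<close>

definition pairing :: "'z::complex_normed_vector cdual \<times> complex \<Rightarrow> 'z \<times> complex \<Rightarrow> complex"
  where "pairing F x = blinfun_apply (blinfun_of_cdual (fst F)) (fst x) + snd F * snd x"

lemma complex_linear_cdual: "complex_linear (blinfun_apply (blinfun_of_cdual g))"
  using blinfun_of_cdual[of g] by simp

lemma complex_linear_pairing: "complex_linear (pairing F)"
  unfolding complex_linear_def
  by (simp add: pairing_def complex_linear_add[OF complex_linear_cdual]
      complex_linear_scaleC[OF complex_linear_cdual] scaleC_prod_def scaleC_complex_def algebra_simps)

lemma pairing_add: "pairing (F + G) x = pairing F x + pairing G x"
  by (simp add: pairing_def plus_cdual.rep_eq blinfun.add_left algebra_simps)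

lemma pairing_scaleC: "pairing (c *\<^sub>C F) x = c * pairing F x"
  by (simp add: pairing_def scaleC_cdual.rep_eq blinfun_apply_cmult scaleC_prod_def scaleC_complex_def algebra_simps)

lemma pairing_eqI:
  assumes "\<And>x. pairing F x = pairing G x" shows "F = G"
proof -
  have "blinfun_apply (blinfun_of_cdual (fst F)) y = blinfun_apply (blinfun_of_cdual (fst G)) y" for y
    using assms[of "(y, 0)"] by (simp add: pairing_def)
  then have "fst F = fst G" by (simp add: blinfun_eqI flip: blinfun_of_cdual_inject)
  moreover have "snd F = snd G" using assms[of "(0, 1)"] by (simp add: pairing_def blinfun.zero_right)
  ultimately show ?thesis by (simp add: prod_eq_iff)
qed

context absolute_norm
begin

text \<open>A functional on the sum is determined by its restriction to Y and its value at (0, 1);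
  the restriction is bounded because \<open>sum_norm\<close> agrees with the norm of Y
  there.\<close>

lemma pairing_representation:
  fixes f :: "'z::complex_normed_vector \<times> complex \<Rightarrow> complex"
  assumes lin: "complex_linear f" and bnd: "\<And>x. cmod (f x) \<le> K * sum_norm x"
  obtains F where "\<And>x. pairing F x = f x"
proof -
  define g where "g y = f (y, 0)" for y :: 'z
  have gl: "complex_linear g"
    unfolding complex_linear_def
  proof safe
    fix x y :: 'z and c
    show "g (x + y) = g x + g y" using complex_linear_add[OF lin, of "(x, 0)" "(y, 0)"] by (simp add: g_def)
    show "g (c *\<^sub>C x) = c *\<^sub>C g x"
      using complex_linear_scaleC[OF lin, of c "(x, 0)"] by (simp add: g_def scaleC_prod_def)
  qed
  have bl: "bounded_linear g"
  proof (rule bounded_linear_intro[where K = K])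
    show "norm (g y) \<le> norm y * K" for y
      using bnd[of "(y, 0)"] left_0[of "norm y"] by (simp add: g_def sum_norm_def mult.commute)
  qed (simp_all add: complex_linear_add[OF gl] complex_linear_scaleR[OF gl])
  define F where "F = (cdual_of_blinfun (Blinfun g), f (0, 1))"
  have "blinfun_of_cdual (cdual_of_blinfun (Blinfun g)) = Blinfun g"
    by (rule cdual_of_blinfun_inverse) (simp add: bounded_linear_Blinfun_apply[OF bl] gl)
  then have "pairing F x = f (fst x, 0) + snd x * f (0, 1)" for x
    by (simp add: F_def pairing_def bounded_linear_Blinfun_apply[OF bl] g_def)
  also have "f (fst x, 0) + snd x * f (0, 1) = f ((fst x, 0) + snd x *\<^sub>C (0, 1))" for x
    by (simp only: complex_linear_add[OF lin] complex_linear_scaleC[OF lin] scaleC_complex_def)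
  also have "(fst x, 0) + snd x *\<^sub>C (0, 1) = x" for x :: "'z \<times> complex"
    by (simp add: prod_eq_iff scaleC_prod_def scaleC_complex_def)
  finally show ?thesis by (rule that)
qed

lemma pairing_le:
  "cmod (pairing F x) \<le> absolute_norm.sum_norm dual F * sum_norm x"
proof -
  interpret d: absolute_norm dual by (rule absolute_norm_dual)
  have "cmod (pairing F x) \<le> norm (fst F) * norm (fst x) + norm (snd F) * norm (snd x)"
    unfolding pairing_def norm_cdual.rep_eq
    by (intro order_trans[OF norm_triangle_ineq] add_mono norm_blinfun) (simp add: norm_mult)
  also have "\<dots> \<le> dual (norm (fst F)) (norm (snd F)) * \<nu> (norm (fst x)) (norm (snd x))"
    by (rule holder) auto
  finally show ?thesis by (simp add: d.sum_norm_def sum_norm_def)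
qed

text \<open>Together with \<open>pairing_le\<close> this identifies the dual sum norm with the norm
  of the functional. A point (a, b) of the planar unit ball is realized by a vector whose entries
  are rotated so that both terms of the pairing are nonnegative and cannot cancel. The norm of
  \<open>fst F\<close> need not be attained, so y stays arbitrary until the operator norm is
  bounded.\<close>

lemma dual_sum_norm_least:
  fixes F :: "'z::complex_normed_vector cdual \<times> complex"
  assumes bnd: "\<And>x. cmod (pairing F x) \<le> K * sum_norm x"
  shows "absolute_norm.sum_norm dual F \<le> K"
proof -
  interpret d: absolute_norm dual by (rule absolute_norm_dual)
  define g where "g = blinfun_apply (blinfun_of_cdual (fst F))"
  have gl: "complex_linear g" unfolding g_def by (rule complex_linear_cdual)
  have K0: "K \<ge> 0" using bnd[of "(0, 1)"] right_0[of 1] order_trans[OF norm_ge_zero] by (fastforce simp: sum_norm_def)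
  have "dual (norm (fst F)) (norm (snd F)) \<le> K"
  proof (rule dual_least)
    fix a b :: real assume ab: "0 \<le> a" "0 \<le> b" "\<nu> a b \<le> 1"
    define m where "m = cmod (snd F) * b"
    obtain sb where sb: "cmod sb = 1" "sb * snd F = of_real (cmod (snd F))" by (rule complex_rotation)
    \<comment> \<open>The bound (K - m)/a for the operator norm has to be nonnegative; for a = 0
      this inequality is already the claim.\<close>
    have mK: "m \<le> K"
    proof -
      have "pairing F (0, sb * of_real b) = of_real m"
        using sb by (simp add: pairing_def blinfun.zero_right m_def algebra_simps)
      then show ?thesis
        using bnd[of "(0, sb * of_real b)"] sb ab unit_le_1[OF ab] right_0[of b] K0
          mult_left_le[of b K]
        by (simp add: sum_norm_def norm_mult m_def)
    qed
    have key: "a * cmod (g y) \<le> (K - m) * norm y" for y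
    proof (cases "y = 0")
      case True
      then show ?thesis by (simp add: complex_linear_zero[OF gl])
    next
      case False
      define r where "r = a / norm y"
      have r: "r \<ge> 0" "r * norm y = a" using False ab by (simp_all add: r_def)
      obtain sa where sa: "cmod sa = 1" "sa * g y = of_real (cmod (g y))" by (rule complex_rotation)
      define x where "x = ((of_real r * sa) *\<^sub>C y, sb * of_real b)"
      have "pairing F x = of_real r * (sa * g y) + of_real b * (sb * snd F)"
        by (simp add: pairing_def x_def g_def[symmetric] complex_linear_scaleC[OF gl]
            scaleC_complex_def mult_ac)
      then have "pairing F x = of_real (r * cmod (g y) + m)"
        unfolding sa sb by (simp add: m_def)
      then have "cmod (pairing F x) = r * cmod (g y) + m"
        using r ab by (simp only: norm_of_real) (simp add: m_def)
      moreover have "sum_norm x = \<nu> a b"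
        using sa sb r ab by (simp add: sum_norm_def x_def norm_scaleC norm_mult)
      ultimately have "r * cmod (g y) + m \<le> K * \<nu> a b" using bnd[of x] by simp
      also have "\<dots> \<le> K" using ab K0 by (simp add: mult_left_le)
      finally have "r * cmod (g y) * norm y \<le> (K - m) * norm y" by (intro mult_right_mono) auto
      then show ?thesis using r(2) by (metis mult.commute mult.left_commute)
    qed
    show "norm (fst F) * a + norm (snd F) * b \<le> K"
    proof (cases "a = 0")
      case True
      then show ?thesis using mK by (simp add: m_def)
    next
      case False
      then have a: "a > 0" using ab by simp
      have "norm (blinfun_of_cdual (fst F)) \<le> (K - m) / a"
        using key a mK by (intro norm_blinfun_bound) (auto simp: g_def field_simps)
      then show ?thesis using a by (simp add: norm_cdual.rep_eq m_def field_simps)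
    qed
  qed
  then show ?thesis by (simp add: d.sum_norm_def)
qed

text \<open>Real Hahn-Banach yields f, and h x = f x - i f (i x) is the complex linear functional
  with real part f. Rotating the argument bounds |h| by the norm.\<close>

lemma norming_functional:
  fixes x0 :: "'z::complex_normed_vector \<times> complex"
  obtains F where "absolute_norm.sum_norm dual F \<le> 1" "cmod (pairing F x0) \<ge> sum_norm x0"
proof -
  let ?P = "sum_norm :: 'z \<times> complex \<Rightarrow> real"
  note N = cnorm_sum_norm[where 'z = 'z]
  have "sublin ?P" by (simp add: sublin_def cnorm_triangle[OF N] cnorm_scaleR[OF N])
  then obtain f where f: "linear f" "\<And>x. f x \<le> ?P x" "f x0 = ?P x0"
    by (rule hahn_banach[where ?x0.0 = x0]) blast
  define h where "h x = Complex (f x) (- f (\<i> *\<^sub>C x))" for x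
  have ii: "\<i> *\<^sub>C \<i> *\<^sub>C x = - x" for x :: "'z \<times> complex"
    unfolding scaleC_scaleC by simp
  have fadd: "f (x + y) = f x + f y" and fsc: "f (r *\<^sub>R x) = r * f x" and fm: "f (- x) = - f x" for x y r
    using f(1) by (simp_all add: linear_add linear_scale linear_neg)
  have hl: "complex_linear h"
    unfolding complex_linear_def
  proof safe
    fix x y :: "'z \<times> complex" and c :: complex
    show "h (x + y) = h x + h y" by (simp add: h_def complex_eq_iff fadd scaleC_add_right)
    have c: "c *\<^sub>C x = Re c *\<^sub>R x + Im c *\<^sub>R (\<i> *\<^sub>C x)" for x :: "'z \<times> complex"
    proof -
      have "Re c *\<^sub>R x + Im c *\<^sub>R (\<i> *\<^sub>C x) = (of_real (Re c) + of_real (Im c) * \<i>) *\<^sub>C x"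
        by (simp only: scaleC_of_real[symmetric] scaleC_scaleC scaleC_add_left)
      also have "of_real (Re c) + of_real (Im c) * \<i> = c" by (simp add: complex_eq_iff)
      finally show ?thesis ..
    qed
    have "\<i> *\<^sub>C c *\<^sub>C x = Re c *\<^sub>R (\<i> *\<^sub>C x) + Im c *\<^sub>R (- x)"
      using c[of "\<i> *\<^sub>C x"] ii[of x] by (simp only: scaleC_scaleC mult.commute)
    then have "f (\<i> *\<^sub>C c *\<^sub>C x) = Re c * f (\<i> *\<^sub>C x) - Im c * f x" by (simp only: fadd fsc fm)
    moreover have "f (c *\<^sub>C x) = Re c * f x + Im c * f (\<i> *\<^sub>C x)" by (subst c) (simp only: fadd fsc)
    ultimately show "h (c *\<^sub>C x) = c *\<^sub>C h x" by (simp add: h_def complex_eq_iff scaleC_complex_def)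
  qed
  have le: "cmod (h x) \<le> 1 * ?P x" for x
  proof -
    obtain s where s: "cmod s = 1" "s * h x = of_real (cmod (h x))" by (rule complex_rotation)
    have "h (s *\<^sub>C x) = of_real (cmod (h x))" using s by (simp add: complex_linear_scaleC[OF hl] scaleC_complex_def)
    then have "cmod (h x) = Re (h (s *\<^sub>C x))" by simp
    also have "\<dots> \<le> ?P (s *\<^sub>C x)" using f(2) by (simp add: h_def)
    finally show ?thesis using s by (simp add: cnorm_scaleC[OF N])
  qed
  obtain F where F: "\<And>x. pairing F x = h x" using pairing_representation[OF hl le] by blast
  have "absolute_norm.sum_norm dual F \<le> 1" by (rule dual_sum_norm_least) (use F le in simp)
  moreover have "cmod (pairing F x0) \<ge> ?P x0"
    using f(3) complex_Re_le_cmod[of "h x0"] by (simp add: F h_def)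
  ultimately show ?thesis by (rule that)
qed

text \<open>The adjoint A' is complex linear because the pairing is bilinear, inherits its norm
  bounds through \<open>dual_sum_norm_least\<close>, and has near-maximizers given by norming
  functionals of A u.\<close>

lemma dual_maximizing_contradiction:
  fixes A :: "'z::complex_banach \<times> complex \<Rightarrow> 'z \<times> complex"
  assumes cuc: "complex_uniformly_convex TYPE('z cdual)" and z: "z0 > 0" "\<nu> z0 1 \<le> 1"
    and lin: "complex_linear A" and M: "M > 0" and bnd: "\<And>u. sum_norm (A u) \<le> M * sum_norm u"
    and c: "c1 > 0" "c2 > 0"
    and F1: "\<And>z u. cmod z \<le> 1 \<Longrightarrow> sum_norm (A u + (z * of_real c1) *\<^sub>C A (A u)) \<le> M * sum_norm u"
    and F2: "\<And>z u. cmod z \<le> 1 \<Longrightarrow> sum_norm (A u + (z * of_real c2) *\<^sub>C A (A (A u))) \<le> M * sum_norm u"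
    and landau: "\<And>e. e > 0 \<Longrightarrow> \<exists>K G. \<forall>u. sum_norm (G u) \<le> K * sum_norm u \<and> G (A (A u)) = A (A (G u)) \<and>
      sum_norm (A u - G (A (A u))) \<le> e * sum_norm u"
    and max: "\<And>\<delta>. \<delta> > 0 \<Longrightarrow> \<exists>u. sum_norm u \<le> 1 \<and> sum_norm (A u) > M - \<delta>"
  shows False
proof -
  interpret d: absolute_norm dual by (rule absolute_norm_dual)
  let ?P = "sum_norm :: 'z \<times> complex \<Rightarrow> real"
  note N = cnorm_sum_norm[where 'z = 'z] and dN = d.cnorm_sum_norm[where 'z = "'z cdual"]
  have "\<exists>G. \<forall>x. pairing G x = pairing F (A x)" for F :: "'z cdual \<times> complex"
  proof -
    have "complex_linear (\<lambda>x. pairing F (A x))"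
      unfolding complex_linear_def
      by (simp add: complex_linear_add[OF lin] complex_linear_add[OF complex_linear_pairing]
          complex_linear_scaleC[OF lin] complex_linear_scaleC[OF complex_linear_pairing])
    moreover have "cmod (pairing F (A x)) \<le> (d.sum_norm F * M) * ?P x" for x
      using pairing_le[of F "A x"] mult_left_mono[OF bnd[of x] cnorm_nonneg[OF dN, of F]]
      by (simp add: mult.assoc)
    ultimately show ?thesis by (rule pairing_representation) blast
  qed
  then obtain A' where A': "\<And>F x. pairing (A' F) x = pairing F (A x)" by metis
  have dual_le: "d.sum_norm F \<le> M * d.sum_norm G"
    if "\<And>x. cmod (pairing F x) = cmod (pairing G (L x))" "\<And>x. ?P (L x) \<le> M * ?P x" for F G L and M :: real
  proof (rule dual_sum_norm_least)
    fix x
    have "cmod (pairing F x) \<le> d.sum_norm G * ?P (L x)" unfolding that by (rule pairing_le)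
    also have "\<dots> \<le> d.sum_norm G * (M * ?P x)" by (intro mult_left_mono that cnorm_nonneg[OF dN])
    finally show "cmod (pairing F x) \<le> M * d.sum_norm G * ?P x" by (simp add: mult_ac)
  qed
  note pl = complex_linear_add[OF complex_linear_pairing] complex_linear_scaleC[OF complex_linear_pairing]
    complex_linear_diff[OF complex_linear_pairing] scaleC_complex_def
  show False
  proof (rule d.maximizing_contradiction[OF cuc _ _ M _ c, of A'])
    show "dual s 1 > 1" if "s > 0" for s using dual_strict[OF z that] .
    show "complex_linear A'"
      unfolding complex_linear_def
      by (intro conjI allI pairing_eqI) (simp_all add: A' pairing_add pairing_scaleC)
    show "d.sum_norm (A' F) \<le> M * d.sum_norm F" for F by (rule dual_le[OF _ bnd]) (simp add: A')
    show "d.sum_norm (A' F + (z * of_real c1) *\<^sub>C A' (A' F)) \<le> M * d.sum_norm F" if "cmod z \<le> 1" for z F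
      by (rule dual_le[OF _ F1[OF that]]) (simp add: A' pairing_add pairing_scaleC pl)
    show "d.sum_norm (A' F + (z * of_real c2) *\<^sub>C A' (A' (A' F))) \<le> M * d.sum_norm F" if "cmod z \<le> 1" for z F
      by (rule dual_le[OF _ F2[OF that]]) (simp add: A' pairing_add pairing_scaleC pl)
    \<comment> \<open>As G commutes with A A, pairing F with G (A (A x)) is pairing A' (A' F) with G
      x; the rest is F tested on A x - G (A (A x)).\<close>
    show "\<exists>K. \<forall>F. d.sum_norm (A' F) \<le> K * d.sum_norm (A' (A' F)) + e * d.sum_norm F" if e: "e > 0" for e
    proof -
      obtain K G where G: "\<And>u. ?P (G u) \<le> K * ?P u" "\<And>u. G (A (A u)) = A (A (G u))"
        "\<And>u. ?P (A u - G (A (A u))) \<le> e * ?P u" using landau[OF e] by blast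
      have "d.sum_norm (A' F) \<le> K * d.sum_norm (A' (A' F)) + e * d.sum_norm F" for F
      proof (rule dual_sum_norm_least)
        fix x
        have "pairing (A' F) x = pairing (A' (A' F)) (G x) + pairing F (A x - G (A (A x)))"
          by (simp add: A' pl G(2))
        then have "cmod (pairing (A' F) x) \<le> cmod (pairing (A' (A' F)) (G x)) + cmod (pairing F (A x - G (A (A x))))"
          by (simp add: norm_triangle_ineq)
        also have "\<dots> \<le> d.sum_norm (A' (A' F)) * ?P (G x) + d.sum_norm F * ?P (A x - G (A (A x)))"
          by (intro add_mono pairing_le)
        also have "\<dots> \<le> d.sum_norm (A' (A' F)) * (K * ?P x) + d.sum_norm F * (e * ?P x)"
          by (intro add_mono mult_left_mono G cnorm_nonneg[OF dN])
        finally show "cmod (pairing (A' F) x) \<le> (K * d.sum_norm (A' (A' F)) + e * d.sum_norm F) * ?P x"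
          by (simp add: algebra_simps)
      qed
      then show ?thesis by blast
    qed
    show "\<exists>F. d.sum_norm F \<le> 1 \<and> d.sum_norm (A' F) > M - \<delta>" if \<delta>: "\<delta> > 0" for \<delta>
    proof -
      obtain u where u: "?P u \<le> 1" "?P (A u) > M - \<delta>" using max[OF \<delta>] by blast
      obtain F where F: "d.sum_norm F \<le> 1" "cmod (pairing F (A u)) \<ge> ?P (A u)"
        using norming_functional[of "A u"] by blast
      have "?P (A u) \<le> d.sum_norm (A' F) * ?P u" using F(2) pairing_le[of "A' F" u] by (simp add: A')
      also have "\<dots> \<le> d.sum_norm (A' F)" using u(1) by (simp add: mult_left_le cnorm_nonneg[OF dN])
      finally show ?thesis using F(1) u(2) by (intro exI[of _ F]) simp
    qed
  qed
qed

end

section \<open>Resolvents of constant norm\<close>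

definition psi_abs :: "(real \<Rightarrow> real) \<Rightarrow> real \<Rightarrow> real \<Rightarrow> real"
  where "psi_abs \<psi> a b = (if a = 0 \<and> b = 0 then 0 else (a + b) * \<psi> (b / (a + b)))"

text \<open>\<open>psi_abs \<psi>\<close> is the perspective of \<psi>, so convexity of \<psi> is
  its subadditivity; the bound max (1 - t) t <= \<psi> t is the pair of coordinate bounds.\<close>

lemma absolute_norm_psi_abs:
  assumes "\<psi> \<in> Psi" shows "absolute_norm (psi_abs \<psi>)"
proof
  have conv: "convex_on {0..1} \<psi>" and \<psi>01: "\<psi> 0 = 1" "\<psi> 1 = 1"
    and \<psi>: "\<And>t. 0 \<le> t \<Longrightarrow> t \<le> 1 \<Longrightarrow> 1 - t \<le> \<psi> t \<and> t \<le> \<psi> t"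
    using assms by (auto simp: Psi_def)
  fix a b a' b' r :: real
  show "psi_abs \<psi> a 0 = a" "psi_abs \<psi> 0 b = b" by (simp_all add: psi_abs_def \<psi>01)
  show "psi_abs \<psi> (r * a) (r * b) = r * psi_abs \<psi> a b" if "0 \<le> r" "0 \<le> a" "0 \<le> b"
    using that by (cases "r = 0") (auto simp: psi_abs_def simp flip: distrib_left)
  have ge: "a \<le> psi_abs \<psi> a b \<and> b \<le> psi_abs \<psi> a b" if "0 \<le> a" "0 \<le> b"
  proof (cases "a + b = 0")
    case False
    then have s: "a + b > 0" using that by simp
    define t where "t = b / (a + b)"
    have t: "0 \<le> t" "t \<le> 1" "(a + b) * t = b" using s that by (auto simp: t_def)
    have "(a + b) * (1 - t) \<le> (a + b) * \<psi> t" "(a + b) * t \<le> (a + b) * \<psi> t"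
      using \<psi>[OF t(1,2)] s by (simp_all add: mult_left_mono del: mult_le_cancel_left_pos)
    moreover have "(a + b) * (1 - t) = a" using t(3) by (simp add: right_diff_distrib)
    moreover have "psi_abs \<psi> a b = (a + b) * \<psi> t" using s by (auto simp: psi_abs_def t_def)
    ultimately show ?thesis using t(3) by simp
  qed (use that in \<open>auto simp: psi_abs_def\<close>)
  show "a \<le> psi_abs \<psi> a b" "b \<le> psi_abs \<psi> a b" if "0 \<le> a" "0 \<le> b" using ge[OF that] by simp_all
  show "psi_abs \<psi> (a + a') (b + b') \<le> psi_abs \<psi> a b + psi_abs \<psi> a' b'"
    if nn: "0 \<le> a" "0 \<le> b" "0 \<le> a'" "0 \<le> b'"
  proof -
    consider "a + b = 0" | "a' + b' = 0" | "a + b > 0" "a' + b' > 0" using nn by linarith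
    then show ?thesis
    proof cases
      case 1
      then have "a = 0" "b = 0" using nn by simp_all
      then show ?thesis by (simp add: psi_abs_def)
    next
      case 2
      then have "a' = 0" "b' = 0" using nn by simp_all
      then show ?thesis by (simp add: psi_abs_def)
    next
      case 3
      \<comment> \<open>Weights proportional to s and s' turn b/s and b'/s' into the convex
        combination (b + b')/(s + s').\<close>
      define s s' t where "s = a + b" and "s' = a' + b'" and "t = s' / (s + s')"
      have s: "s > 0" "s' > 0" using 3 by (auto simp: s_def s'_def)
      have t: "0 \<le> t" "t \<le> 1" "(s + s') * t = s'" using s by (auto simp: t_def)
      have t': "(s + s') * (1 - t) = s" using t(3) by (simp add: right_diff_distrib)
      have bs: "b / s \<in> {0..1}" "b' / s' \<in> {0..1}" using s nn by (auto simp: s_def s'_def)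
      have "\<psi> ((1 - t) *\<^sub>R (b / s) + t *\<^sub>R (b' / s')) \<le> (1 - t) * \<psi> (b / s) + t * \<psi> (b' / s')"
        using convex_onD[OF conv t(1,2) bs] .
      moreover have "(1 - t) *\<^sub>R (b / s) + t *\<^sub>R (b' / s') = (b + b') / (s + s')"
      proof -
        define x where "x = (1 - t) * (b / s) + t * (b' / s')"
        have "(s + s') * x = ((s + s') * (1 - t)) * (b / s) + ((s + s') * t) * (b' / s')"
          unfolding x_def by (simp only: distrib_left mult.assoc)
        also have "\<dots> = b + b'" unfolding t t' using s by simp
        finally have "x = (b + b') / (s + s')" using s by (simp add: field_simps)
        then show ?thesis by (simp add: x_def)
      qed
      ultimately have "(s + s') * \<psi> ((b + b') / (s + s'))
          \<le> (s + s') * ((1 - t) * \<psi> (b / s) + t * \<psi> (b' / s'))"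
        using s by (intro mult_left_mono) auto
      also have "\<dots> = ((s + s') * (1 - t)) * \<psi> (b / s) + ((s + s') * t) * \<psi> (b' / s')"
        by (simp add: algebra_simps)
      also have "\<dots> = s * \<psi> (b / s) + s' * \<psi> (b' / s')" unfolding t t' ..
      finally show ?thesis
        using s nn by (auto simp: psi_abs_def s_def s'_def algebra_simps)
    qed
  qed
qed

section \<open>Operator norms and near-maximizers\<close>

lemma op_norm_upper:
  assumes N: "cnorm N" and A: "bounded_op N A"
  shows "N (A x) \<le> op_norm N A * N x"
proof (cases "x = 0")
  case True
  then show ?thesis by (simp add: complex_linear_zero[OF bounded_opD(1)[OF A N]] cnorm_zero[OF N])
next
  case False
  then have x: "N x > 0" using cnorm_nonneg[OF N, of x] cnorm_eq_0D[OF N, of x] by force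
  obtain K where K: "K \<ge> 0" "\<forall>x. N (A x) \<le> K * N x" using bounded_opD(2)[OF A N] by blast
  have "N (A y) / N y \<le> K" for y
    using K cnorm_nonneg[OF N, of y] by (cases "N y = 0") (auto simp: divide_le_eq)
  then have "bdd_above (range (\<lambda>x. N (A x) / N x))" by (rule bdd_aboveI2)
  then have "N (A x) / N x \<le> op_norm N A" unfolding op_norm_def by (intro cSUP_upper) auto
  then show ?thesis using x by (simp add: divide_le_eq)
qed

lemma op_norm_approx:
  assumes N: "cnorm N" and M: "0 < M" "M \<le> op_norm N A" and lin: "complex_linear A" and d: "d > 0"
  obtains u where "N u \<le> 1" "N (A u) > M - d"
proof -
  \<comment> \<open>Capping d by M keeps M - d' nonnegative, so the quotient at x is positive; this
    excludes N x = 0, where the quotient is 0.\<close>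
  define d' where "d' = min d M"
  have d': "d' > 0" "d' \<le> d" "d' \<le> M" using d M by (auto simp: d'_def)
  have "\<exists>x. N (A x) / N x > M - d'"
  proof (rule ccontr)
    assume "\<not> ?thesis"
    then have "op_norm N A \<le> M - d'" unfolding op_norm_def by (intro cSUP_least) (auto simp: not_less)
    then show False using M d' by simp
  qed
  then obtain x where x: "N (A x) / N x > M - d'" by blast
  then have "N x \<noteq> 0" using d' by auto
  then have Nx: "N x > 0" using cnorm_nonneg[OF N, of x] by simp
  show ?thesis
  proof
    show "N ((1 / N x) *\<^sub>R x) \<le> 1" using Nx by (simp add: cnorm_scaleR[OF N])
    show "N (A ((1 / N x) *\<^sub>R x)) > M - d"
      using Nx x d' by (simp add: cnorm_scaleR[OF N] complex_linear_scaleR[OF lin])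
  qed
qed

theorem theorem3p3:
  fixes \<Omega> :: "complex set"
    and \<psi> :: "real \<Rightarrow> real"
    and D :: "('a::complex_banach \<times> complex) set"
    and B :: "'a \<times> complex \<Rightarrow> 'a \<times> complex"
    and M :: real
  assumes "open \<Omega>"
    and "\<psi> \<in> Psi"
    and "complex_uniformly_convex TYPE('a)"
    and "complex_uniformly_convex TYPE('a cdual)"
    and "\<exists>T. C0_semigroup (psi_sum_norm \<psi>) T \<and> is_generator (psi_sum_norm \<psi>) T D B"
    and "\<forall>\<mu>\<in>\<Omega>. \<mu> \<in> resolvent_set (psi_sum_norm \<psi>) D B"
    and "\<forall>\<mu>\<in>\<Omega>. op_norm (psi_sum_norm \<psi>) (resolvent D B \<mu>) \<le> M"
  shows "\<forall>\<mu>\<in>\<Omega>. op_norm (psi_sum_norm \<psi>) (resolvent D B \<mu>) < M"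
proof (rule ballI, rule ccontr)
  fix \<mu> assume \<mu>: "\<mu> \<in> \<Omega>"
  interpret absolute_norm "psi_abs \<psi>" by (rule absolute_norm_psi_abs) fact
  define N where "N = (psi_sum_norm \<psi> :: 'a \<times> complex \<Rightarrow> real)"
  have N_eq: "N = sum_norm"
    by (auto simp: N_def fun_eq_iff psi_sum_norm_def psi_norm_def sum_norm_def psi_abs_def)
  have N: "cnorm N" unfolding N_eq by (rule cnorm_sum_norm)
  obtain T where S: "C0_semigroup N T" and gen: "is_generator N T D B"
    using assms(5) by (auto simp: N_def)
  have res: "\<And>\<nu>. \<nu> \<in> \<Omega> \<Longrightarrow> \<nu> \<in> resolvent_set N D B" using assms(6) by (simp add: N_def)
  have bnd: "N (resolvent D B \<nu> u) \<le> M * N u" if "\<nu> \<in> \<Omega>" for \<nu> u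
  proof -
    have "N (resolvent D B \<nu> u) \<le> op_norm N (resolvent D B \<nu>) * N u"
      by (rule op_norm_upper[OF N resolventD(4)[OF res[OF that]]])
    also have "\<dots> \<le> M * N u"
      using assms(7) that by (intro mult_right_mono cnorm_nonneg[OF N]) (simp add: N_def)
    finally show ?thesis .
  qed
  define R where "R = resolvent D B \<mu>"
  assume "\<not> op_norm (psi_sum_norm \<psi>) (resolvent D B \<mu>) < M"
  then have MR: "M \<le> op_norm N R" by (simp add: N_def R_def)
  have lin: "complex_linear R" unfolding R_def by (rule bounded_opD(1)[OF resolventD(4)[OF res[OF \<mu>]] N])
  have bR: "N (R u) \<le> M * N u" for u unfolding R_def by (rule bnd[OF \<mu>])
  \<comment> \<open>For M <= 0 the resolvent would be 0, and B 0 = u would hold for every u.\<close>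
  have M: "M > 0"
  proof (rule ccontr)
    assume "\<not> M > 0"
    then have "N (R u) \<le> 0" for u
      using bR[of u] cnorm_nonneg[OF N, of u] by (meson mult_nonpos_nonneg not_less order_trans)
    then have "R u = 0" for u
      using cnorm_eq_0D[OF N, of "R u"] cnorm_nonneg[OF N, of "R u"] by (simp add: order_antisym)
    then have "B 0 = u" for u using resolventD(2)[OF res[OF \<mu>], of u] by (simp add: R_def)
    from this[of 0] this[of "(0, 1)"] show False by (simp add: prod_eq_iff)
  qed
  obtain c1 where c1: "c1 > 0" "\<And>z u. cmod z \<le> 1 \<Longrightarrow> N (R u + (z * of_real c1) *\<^sub>C (R ^^ (1 + 1)) u) \<le> M * N u"
    using resolvent_fejer[OF N assms(1) \<mu> res bnd R_def zero_less_one M] by metis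
  obtain c2 where c2: "c2 > 0" "\<And>z u. cmod z \<le> 1 \<Longrightarrow> N (R u + (z * of_real c2) *\<^sub>C (R ^^ (2 + 1)) u) \<le> M * N u"
    using resolvent_fejer[OF N assms(1) \<mu> res bnd R_def zero_less_numeral M] by metis
  have F1: "N (R u + (z * of_real c1) *\<^sub>C R (R u)) \<le> M * N u" if "cmod z \<le> 1" for z u
    using c1(2)[OF that, of u] by simp
  have F2: "N (R u + (z * of_real c2) *\<^sub>C R (R (R u))) \<le> M * N u" if "cmod z \<le> 1" for z u
    using c2(2)[OF that, of u] by (simp add: numeral_2_eq_2)
  \<comment> \<open>The product type carries its own complete Euclidean norm; the constant 2
    compares it with the \<psi>-norm in both directions.\<close>
  have eqv: "norm x \<le> 2 * N x" "N x \<le> 2 * norm x" for x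
  proof -
    show "norm x \<le> 2 * N x"
      using norm_Pair_le[of "fst x" "snd x"] sum_norm_ge[of x] by (simp add: N_eq)
    show "N x \<le> 2 * norm x"
      using sum_norm_le[of x] norm_fst_le[of "fst x" "snd x"] norm_snd_le[of "snd x" "fst x"] by (simp add: N_eq)
  qed
  have landau: "\<exists>K G. \<forall>u. N (G u) \<le> K * N u \<and> G (R (R u)) = R (R (G u)) \<and> N (R u - G (R (R u))) \<le> e * N u"
    if e: "e > 0" for e
    by (rule resolvent_landau[OF N S gen eqv _ _ res[OF \<mu>] R_def e]) (simp, simp, blast)
  have max: "\<exists>u. N u \<le> 1 \<and> N (R u) > M - \<delta>" if "\<delta> > 0" for \<delta>
    using op_norm_approx[OF N M MR lin that] by metis
  show False
  proof (cases "\<forall>s>0. psi_abs \<psi> s 1 > 1")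
    case True
    have landau': "\<exists>K. \<forall>u. N (R u) \<le> K * N (R (R u)) + e * N u" if e: "e > 0" for e
    proof -
      obtain K G where G: "\<And>u. N (G u) \<le> K * N u" "\<And>u. N (R u - G (R (R u))) \<le> e * N u"
        using landau[OF e] by blast
      have "N (R u) \<le> K * N (R (R u)) + e * N u" for u
        using cnorm_triangle_sub[OF N, of "R u" "G (R (R u))"] G(1)[of "R (R u)"] G(2)[of u] by simp
      then show ?thesis by blast
    qed
    show False
      using maximizing_contradiction[OF assms(3) _ lin M bR[unfolded N_eq] c1(1) c2(1) F1[unfolded N_eq]
          F2[unfolded N_eq] landau'[unfolded N_eq] max[unfolded N_eq]] True by blast
  next
    case False
    then obtain z0 where z0: "z0 > 0" "psi_abs \<psi> z0 1 \<le> 1" by (auto simp: not_less)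
    show False
      by (rule dual_maximizing_contradiction[OF assms(4) z0 lin M bR[unfolded N_eq] c1(1) c2(1) F1[unfolded N_eq]
          F2[unfolded N_eq] landau[unfolded N_eq] max[unfolded N_eq]])
  qed
qed

end
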